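(* Let $T=\mathbb Ze\oplus\mathbb Zf$, $\Gamma=\mathbb Z$, with ternary operation $x\,n\,y\,m\,z=nm[x,y,z]$, where $[\cdot,\cdot,\cdot]$ is trilinear, $[e,e,e]=f$, and every other product of basis elements is zero. Then $$\mathcal O(T,\mathbb Z)=\mathbb Zp\oplus\mathbb Zq,\qquad p^2=q,\qquad pq=qp=q^2=0.$$ The regular action satisfies $p(e)=f$, $p(f)=0$, $q(T)=0$. Therefore $$\mathfrak D(T,\mathbb Z)=\mathfrak K(T,\mathbb Z)=\mathbb Zq,\qquad\mathcal C(T,\mathbb Z)=\mathbb Zq.$$ Moreover, writing $K=\mathfrak K(T,\mathbb Z)$, $$\mathcal A(T,\mathbb Z)\cong\mathbb Z[p]/(p^3),\qquad\mathcal R_T\cong\mathbb Z[p]/(p^2),\qquad K=(p^2).$$ The regular extension class $\Omega(T,\mathbb Z)$ is nonzero.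
   Context: For an additive ternary $\Gamma$-ring $T$ (abelian groups $T,\Gamma$ with an operation $x\alpha y\beta z\in T$ additive in all five variables and satisfying $(x\alpha y\beta z)\gamma u\delta v=x\alpha(y\beta z\gamma u)\delta v=x\alpha y\beta(z\gamma u\delta v)$): $F(T,\Gamma)=T\otimes_{\mathbb Z}\Gamma\otimes_{\mathbb Z}T\otimes_{\mathbb Z}\Gamma$ carries the associative multiplication $(a\otimes\alpha\otimes b\otimes\beta)(c\otimes\gamma\otimes d\otimes\delta)=(a\alpha b\beta c)\otimes\gamma\otimes d\otimes\delta$; $\mathcal O(T,\Gamma)$ is its quotient by the two-sided ideal generated by all $(a\alpha b\beta c)\otimes\gamma\otimes d\otimes\delta-a\otimes\alpha\otimes(b\beta c\gamma d)\otimes\delta$; $[a,\alpha,b,\beta]$ is the class of a pure tensor; $\mathcal A(T,\Gamma)=\mathbb Z\oplus\mathcal O(T,\Gamma)$ with $(n,r)(m,s)=(nm,ns+mr+rs)$. The regular representation is $\rho_T:\mathcal O(T,\Gamma)\to\operatorname{End}_{\mathbb Z}(T)$, $\rho_T([a,\alpha,b,\beta])(x)=a\alpha b\beta x$, and $\widehat\rho_T(n,u)=n\operatorname{id}_T+\rho_T(u)$ on $\mathcal A(T,\Gamma)$. Then $\mathfrak D(T,\Gamma)=\ker\rho_T$, $\mathfrak K(T,\Gamma)=\ker\widehat\rho_T$, $\mathcal R_T=\operatorname{im}\widehat\rho_T$, and $\mathcal C(T,\Gamma)=\mathfrak K/\mathfrak K^2$. $\mathcal O(T,\Gamma)$ is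 viewed inside $\mathcal A(T,\Gamma)$ via $u\mapsto(0,u)$. Here, with $\Gamma=\mathbb Z$, $F(T,\mathbb Z)=T\otimes T$; $p$ is the class of $e\otimes e$ and $q$ is the common class of $f\otimes e$ and $e\otimes f$. When $K=\mathfrak K(T,\Gamma)$ satisfies $K^2=0$ and $\mathcal A\twoheadrightarrow\mathcal R_T$ has an additive section $s$ with $s(1)=1$, the regular extension class $\Omega(T,\Gamma)\in\operatorname{HH}^2_{\mathbb Z}(\mathcal R_T,K)$ (Hochschild cohomology over $\mathbb Z$, standard cochain complex) is the class of the cocycle $\omega_s(r,r')=s(r)s(r')-s(rr')$; it does not depend on $s$. *)

theory Defs
  imports "HOL-Algebra.Algebra" "HOL-Library.Product_Plus"
begin

section \<open>Additive ternary Gamma-rings\<close>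

text \<open>The abelian groups \<open>T\<close> and \<open>\<Gamma>\<close> are the types \<open>'t\<close> and \<open>'g\<close>;
  \<open>tp x \<alpha> y \<beta> z\<close> is the product \<open>x\<alpha>y\<beta>z\<close>.\<close>

locale ternary_gamma_ring =
  fixes tp :: "'t::ab_group_add \<Rightarrow> 'g::ab_group_add \<Rightarrow> 't \<Rightarrow> 'g \<Rightarrow> 't \<Rightarrow> 't"
  assumes add1: "tp (x + x') \<alpha> y \<beta> z = tp x \<alpha> y \<beta> z + tp x' \<alpha> y \<beta> z"
    and add2: "tp x (\<alpha> + \<alpha>') y \<beta> z = tp x \<alpha> y \<beta> z + tp x \<alpha>' y \<beta> z"
    and add3: "tp x \<alpha> (y + y') \<beta> z = tp x \<alpha> y \<beta> z + tp x \<alpha> y' \<beta> z"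
    and add4: "tp x \<alpha> y (\<beta> + \<beta>') z = tp x \<alpha> y \<beta> z + tp x \<alpha> y \<beta>' z"
    and add5: "tp x \<alpha> y \<beta> (z + z') = tp x \<alpha> y \<beta> z + tp x \<alpha> y \<beta> z'"
    and assoc1: "tp (tp x \<alpha> y \<beta> z) \<gamma> u \<delta> v = tp x \<alpha> (tp y \<beta> z \<gamma> u) \<delta> v"
    and assoc2: "tp x \<alpha> (tp y \<beta> z \<gamma> u) \<delta> v = tp x \<alpha> y \<beta> (tp z \<gamma> u \<delta> v)"


section \<open>The ring \<open>F(T,\<Gamma>)\<close>\<close>

text \<open>\<open>T \<otimes> \<Gamma> \<otimes> T \<otimes> \<Gamma>\<close> is the free abelian group on quadruples modulo the relations of
  additivity in each slot. The rings below, up to and including \<open>\<O>(T,\<Gamma>)\<close>, need not have a unit: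
  the field \<^const>\<open>one\<close> of their records is a placeholder and is never used.\<close>

definition quad_ring ::
  "('t::ab_group_add \<Rightarrow> 'g::ab_group_add \<Rightarrow> 't \<Rightarrow> 'g \<Rightarrow> 't \<Rightarrow> 't) \<Rightarrow> (('t \<times> 'g \<times> 't \<times> 'g) \<Rightarrow>\<^sub>0 int) ring"
  where "quad_ring tp = \<lparr>carrier = UNIV,
     monoid.mult = (\<lambda>x y. frag_extend (\<lambda>(a, \<alpha>, b, \<beta>).
                     frag_extend (\<lambda>(c, \<gamma>, d, \<delta>). frag_of (tp a \<alpha> b \<beta> c, \<gamma>, d, \<delta>)) y) x),
     one = 0, ring.zero = 0, ring.add = (+)\<rparr>"

definition tensor_relators :: "(('t::ab_group_add \<times> 'g::ab_group_add \<times> 't \<times> 'g) \<Rightarrow>\<^sub>0 int) set"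
  where "tensor_relators =
     {frag_of (a + a', \<alpha>, b, \<beta>) - frag_of (a, \<alpha>, b, \<beta>) - frag_of (a', \<alpha>, b, \<beta>) | a a' \<alpha> b \<beta>. True} \<union>
     {frag_of (a, \<alpha> + \<alpha>', b, \<beta>) - frag_of (a, \<alpha>, b, \<beta>) - frag_of (a, \<alpha>', b, \<beta>) | a \<alpha> \<alpha>' b \<beta>. True} \<union>
     {frag_of (a, \<alpha>, b + b', \<beta>) - frag_of (a, \<alpha>, b, \<beta>) - frag_of (a, \<alpha>, b', \<beta>) | a \<alpha> b b' \<beta>. True} \<union>
     {frag_of (a, \<alpha>, b, \<beta> + \<beta>') - frag_of (a, \<alpha>, b, \<beta>) - frag_of (a, \<alpha>, b, \<beta>') | a \<alpha> b \<beta> \<beta>'. True}"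

definition tensor_kernel ::
  "('t::ab_group_add \<Rightarrow> 'g::ab_group_add \<Rightarrow> 't \<Rightarrow> 'g \<Rightarrow> 't \<Rightarrow> 't) \<Rightarrow> (('t \<times> 'g \<times> 't \<times> 'g) \<Rightarrow>\<^sub>0 int) set"
  where "tensor_kernel tp = generate (add_monoid (quad_ring tp)) tensor_relators"

definition F_ring ::
  "('t::ab_group_add \<Rightarrow> 'g::ab_group_add \<Rightarrow> 't \<Rightarrow> 'g \<Rightarrow> 't \<Rightarrow> 't) \<Rightarrow> (('t \<times> 'g \<times> 't \<times> 'g) \<Rightarrow>\<^sub>0 int) set ring"
  where "F_ring tp = quad_ring tp Quot tensor_kernel tp"

definition pure_tensor ::
  "('t::ab_group_add \<Rightarrow> 'g::ab_group_add \<Rightarrow> 't \<Rightarrow> 'g \<Rightarrow> 't \<Rightarrow> 't)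
     \<Rightarrow> 't \<Rightarrow> 'g \<Rightarrow> 't \<Rightarrow> 'g \<Rightarrow> (('t \<times> 'g \<times> 't \<times> 'g) \<Rightarrow>\<^sub>0 int) set"
  where "pure_tensor tp a \<alpha> b \<beta> = tensor_kernel tp +>\<^bsub>quad_ring tp\<^esub> frag_of (a, \<alpha>, b, \<beta>)"


section \<open>The operator rings \<open>\<O>(T,\<Gamma>)\<close> and \<open>\<A>(T,\<Gamma>)\<close>\<close>

text \<open>The library's \<^const>\<open>genideal\<close> presupposes a unital ring, so it cannot be used in \<open>F(T,\<Gamma>)\<close>.\<close>

definition rng_ideal :: "'a set \<Rightarrow> ('a, 'b) ring_scheme \<Rightarrow> bool"
  where "rng_ideal I R \<longleftrightarrow> additive_subgroup I R \<and>
     (\<forall>a\<in>I. \<forall>x\<in>carrier R. x \<otimes>\<^bsub>R\<^esub> a \<in> I \<and> a \<otimes>\<^bsub>R\<^esub> x \<in> I)"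

definition rng_genideal :: "('a, 'b) ring_scheme \<Rightarrow> 'a set \<Rightarrow> 'a set"
  where "rng_genideal R S = \<Inter>{I. rng_ideal I R \<and> S \<subseteq> I}"

definition assoc_ideal ::
  "('t::ab_group_add \<Rightarrow> 'g::ab_group_add \<Rightarrow> 't \<Rightarrow> 'g \<Rightarrow> 't \<Rightarrow> 't) \<Rightarrow> (('t \<times> 'g \<times> 't \<times> 'g) \<Rightarrow>\<^sub>0 int) set set"
  where "assoc_ideal tp = rng_genideal (F_ring tp)
     {pure_tensor tp (tp a \<alpha> b \<beta> c) \<gamma> d \<delta> \<ominus>\<^bsub>F_ring tp\<^esub> pure_tensor tp a \<alpha> (tp b \<beta> c \<gamma> d) \<delta>
        | a \<alpha> b \<beta> c \<gamma> d \<delta>. True}"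

type_synonym ('t, 'g) op_elem = "(('t \<times> 'g \<times> 't \<times> 'g) \<Rightarrow>\<^sub>0 int) set set"

definition O_ring ::
  "('t::ab_group_add \<Rightarrow> 'g::ab_group_add \<Rightarrow> 't \<Rightarrow> 'g \<Rightarrow> 't \<Rightarrow> 't) \<Rightarrow> ('t, 'g) op_elem ring"
  where "O_ring tp = F_ring tp Quot assoc_ideal tp"

text \<open>The class \<open>[a,\<alpha>,b,\<beta>]\<close> of a pure tensor.\<close>

definition op_class ::
  "('t::ab_group_add \<Rightarrow> 'g::ab_group_add \<Rightarrow> 't \<Rightarrow> 'g \<Rightarrow> 't \<Rightarrow> 't)
     \<Rightarrow> 't \<Rightarrow> 'g \<Rightarrow> 't \<Rightarrow> 'g \<Rightarrow> ('t, 'g) op_elem"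
  where "op_class tp a \<alpha> b \<beta> = assoc_ideal tp +>\<^bsub>F_ring tp\<^esub> pure_tensor tp a \<alpha> b \<beta>"

definition A_ring ::
  "('t::ab_group_add \<Rightarrow> 'g::ab_group_add \<Rightarrow> 't \<Rightarrow> 'g \<Rightarrow> 't \<Rightarrow> 't) \<Rightarrow> (int \<times> ('t, 'g) op_elem) ring"
  where "A_ring tp = \<lparr>carrier = UNIV \<times> carrier (O_ring tp),
     monoid.mult = (\<lambda>(n, r) (m, s). (n * m, [n] \<cdot>\<^bsub>O_ring tp\<^esub> s \<oplus>\<^bsub>O_ring tp\<^esub> [m] \<cdot>\<^bsub>O_ring tp\<^esub> r
                                       \<oplus>\<^bsub>O_ring tp\<^esub> r \<otimes>\<^bsub>O_ring tp\<^esub> s)),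
     one = (1, \<zero>\<^bsub>O_ring tp\<^esub>),
     ring.zero = (0, \<zero>\<^bsub>O_ring tp\<^esub>),
     ring.add = (\<lambda>(n, r) (m, s). (n + m, r \<oplus>\<^bsub>O_ring tp\<^esub> s))\<rparr>"

definition O_emb :: "('t, 'g) op_elem \<Rightarrow> int \<times> ('t, 'g) op_elem"
  where "O_emb u = (0, u)"


section \<open>The regular representation\<close>

definition End_ring :: "('t::ab_group_add \<Rightarrow> 't) ring"
  where "End_ring = \<lparr>carrier = {h. additive h}, monoid.mult = (\<circ>), one = id,
     ring.zero = (\<lambda>_. 0), ring.add = (\<lambda>g h x. g x + h x)\<rparr>"

text \<open>The additive map determined by its values on the classes of pure tensors, which generate
  \<open>\<O>(T,\<Gamma>)\<close>.\<close>

definition reg_rep ::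
  "('t::ab_group_add \<Rightarrow> 'g::ab_group_add \<Rightarrow> 't \<Rightarrow> 'g \<Rightarrow> 't \<Rightarrow> 't) \<Rightarrow> ('t, 'g) op_elem \<Rightarrow> 't \<Rightarrow> 't"
  where "reg_rep tp = (THE \<rho>. \<rho> \<in> hom (add_monoid (O_ring tp)) (add_monoid End_ring) \<and>
     \<rho> \<in> extensional (carrier (O_ring tp)) \<and>
     (\<forall>a \<alpha> b \<beta> x. \<rho> (op_class tp a \<alpha> b \<beta>) x = tp a \<alpha> b \<beta> x))"

definition reg_rep_hat ::
  "('t::ab_group_add \<Rightarrow> 'g::ab_group_add \<Rightarrow> 't \<Rightarrow> 'g \<Rightarrow> 't \<Rightarrow> 't) \<Rightarrow> int \<times> ('t, 'g) op_elem \<Rightarrow> 't \<Rightarrow> 't"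
  where "reg_rep_hat tp = (\<lambda>(n, u). [n] \<cdot>\<^bsub>End_ring\<^esub> id \<oplus>\<^bsub>End_ring\<^esub> reg_rep tp u)"

definition D_ker ::
  "('t::ab_group_add \<Rightarrow> 'g::ab_group_add \<Rightarrow> 't \<Rightarrow> 'g \<Rightarrow> 't \<Rightarrow> 't) \<Rightarrow> ('t, 'g) op_elem set"
  where "D_ker tp = a_kernel (O_ring tp) End_ring (reg_rep tp)"

definition K_ker ::
  "('t::ab_group_add \<Rightarrow> 'g::ab_group_add \<Rightarrow> 't \<Rightarrow> 'g \<Rightarrow> 't \<Rightarrow> 't) \<Rightarrow> (int \<times> ('t, 'g) op_elem) set"
  where "K_ker tp = a_kernel (A_ring tp) End_ring (reg_rep_hat tp)"

definition R_im ::
  "('t::ab_group_add \<Rightarrow> 'g::ab_group_add \<Rightarrow> 't \<Rightarrow> 'g \<Rightarrow> 't \<Rightarrow> 't) \<Rightarrow> ('t \<Rightarrow> 't) ring"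
  where "R_im tp = End_ring\<lparr>carrier := reg_rep_hat tp ` carrier (A_ring tp)\<rparr>"

definition K_sq ::
  "('t::ab_group_add \<Rightarrow> 'g::ab_group_add \<Rightarrow> 't \<Rightarrow> 'g \<Rightarrow> 't \<Rightarrow> 't) \<Rightarrow> (int \<times> ('t, 'g) op_elem) set"
  where "K_sq tp = ideal_prod (A_ring tp) (K_ker tp) (K_ker tp)"

definition K_group ::
  "('t::ab_group_add \<Rightarrow> 'g::ab_group_add \<Rightarrow> 't \<Rightarrow> 'g \<Rightarrow> 't \<Rightarrow> 't) \<Rightarrow> (int \<times> ('t, 'g) op_elem) monoid"
  where "K_group tp = (add_monoid (A_ring tp))\<lparr>carrier := K_ker tp\<rparr>"

definition C_group ::
  "('t::ab_group_add \<Rightarrow> 'g::ab_group_add \<Rightarrow> 't \<Rightarrow> 'g \<Rightarrow> 't \<Rightarrow> 't) \<Rightarrow> (int \<times> ('t, 'g) op_elem) set monoid"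
  where "C_group tp = K_group tp Mod K_sq tp"


section \<open>Hochschild cohomology over \<open>\<int>\<close>\<close>

text \<open>Only the additive structure of the underlying ring record of a bimodule is used. An
  \<open>n\<close>-cochain is an \<open>n\<close>-additive map, given as a function on lists of length \<open>n\<close> (extensional, so
  that equality of functions is equality of cochains).\<close>

record ('r, 'm) bimodule = "'m ring" +
  lact :: "'r \<Rightarrow> 'm \<Rightarrow> 'm"
  ract :: "'m \<Rightarrow> 'r \<Rightarrow> 'm"

definition tuples :: "('r, 'b) ring_scheme \<Rightarrow> nat \<Rightarrow> 'r list set"
  where "tuples R n = {xs. length xs = n \<and> set xs \<subseteq> carrier R}"

definition hh_cochains :: "('r, 'b) ring_scheme \<Rightarrow> ('r, 'm) bimodule \<Rightarrow> nat \<Rightarrow> ('r list \<Rightarrow> 'm) monoid"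
  where "hh_cochains R M n = \<lparr>
     carrier = {f \<in> tuples R n \<rightarrow>\<^sub>E carrier M. \<forall>xs\<in>tuples R n. \<forall>i<n. \<forall>x\<in>carrier R. \<forall>y\<in>carrier R.
                  f (xs[i := x \<oplus>\<^bsub>R\<^esub> y]) = f (xs[i := x]) \<oplus>\<^bsub>M\<^esub> f (xs[i := y])},
     monoid.mult = (\<lambda>f g. \<lambda>xs\<in>tuples R n. f xs \<oplus>\<^bsub>M\<^esub> g xs),
     one = (\<lambda>xs\<in>tuples R n. \<zero>\<^bsub>M\<^esub>)\<rparr>"

definition hh_diff ::
  "('r, 'b) ring_scheme \<Rightarrow> ('r, 'm) bimodule \<Rightarrow> nat \<Rightarrow> ('r list \<Rightarrow> 'm) \<Rightarrow> 'r list \<Rightarrow> 'm"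
  where "hh_diff R M n f = (\<lambda>xs\<in>tuples R (Suc n).
     lact M (hd xs) (f (tl xs))
     \<oplus>\<^bsub>M\<^esub> (\<Oplus>\<^bsub>M\<^esub>i\<in>{..<n}. add_pow M ((- 1 :: int) ^ Suc i)
            (f (take i xs @ [xs ! i \<otimes>\<^bsub>R\<^esub> xs ! Suc i] @ drop (Suc (Suc i)) xs)))
     \<oplus>\<^bsub>M\<^esub> add_pow M ((- 1 :: int) ^ Suc n) (ract M (f (butlast xs)) (last xs)))"

definition hh_cocycles :: "('r, 'b) ring_scheme \<Rightarrow> ('r, 'm) bimodule \<Rightarrow> nat \<Rightarrow> ('r list \<Rightarrow> 'm) monoid"
  where "hh_cocycles R M n = (hh_cochains R M n)
     \<lparr>carrier := {f \<in> carrier (hh_cochains R M n). hh_diff R M n f = \<one>\<^bsub>hh_cochains R M (Suc n)\<^esub>}\<rparr>"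

fun hh_coboundaries :: "('r, 'b) ring_scheme \<Rightarrow> ('r, 'm) bimodule \<Rightarrow> nat \<Rightarrow> ('r list \<Rightarrow> 'm) set"
  where "hh_coboundaries R M 0 = {\<one>\<^bsub>hh_cochains R M 0\<^esub>}"
  | "hh_coboundaries R M (Suc n) = hh_diff R M n ` carrier (hh_cochains R M n)"

definition HH :: "('r, 'b) ring_scheme \<Rightarrow> ('r, 'm) bimodule \<Rightarrow> nat \<Rightarrow> ('r list \<Rightarrow> 'm) set monoid"
  where "HH R M n = hh_cocycles R M n Mod hh_coboundaries R M n"

definition hh_class :: "('r, 'b) ring_scheme \<Rightarrow> ('r, 'm) bimodule \<Rightarrow> nat \<Rightarrow> ('r list \<Rightarrow> 'm) \<Rightarrow> ('r list \<Rightarrow> 'm) set"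
  where "hh_class R M n z = hh_coboundaries R M n #>\<^bsub>hh_cocycles R M n\<^esub> z"


section \<open>The regular extension class\<close>

text \<open>When \<open>K\<^sup>2 = 0\<close>, an element \<open>r\<close> of \<open>\<R>\<^sub>T\<close> acts on \<open>K\<close> by multiplication with any lift of \<open>r\<close>
  to \<open>\<A>(T,\<Gamma>)\<close>; the choice of the lift is then immaterial.\<close>

definition K_bimodule ::
  "('t::ab_group_add \<Rightarrow> 'g::ab_group_add \<Rightarrow> 't \<Rightarrow> 'g \<Rightarrow> 't \<Rightarrow> 't)
     \<Rightarrow> ('t \<Rightarrow> 't, int \<times> ('t, 'g) op_elem) bimodule"
  where "K_bimodule tp = \<lparr>carrier = K_ker tp, monoid.mult = monoid.mult (A_ring tp), one = monoid.one (A_ring tp),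
     ring.zero = ring.zero (A_ring tp), ring.add = ring.add (A_ring tp),
     lact = (\<lambda>r k. THE y. \<forall>a\<in>carrier (A_ring tp). reg_rep_hat tp a = r \<longrightarrow> y = a \<otimes>\<^bsub>A_ring tp\<^esub> k),
     ract = (\<lambda>k r. THE y. \<forall>a\<in>carrier (A_ring tp). reg_rep_hat tp a = r \<longrightarrow> y = k \<otimes>\<^bsub>A_ring tp\<^esub> a)\<rparr>"

definition unital_additive_section ::
  "('t::ab_group_add \<Rightarrow> 'g::ab_group_add \<Rightarrow> 't \<Rightarrow> 'g \<Rightarrow> 't \<Rightarrow> 't)
     \<Rightarrow> (('t \<Rightarrow> 't) \<Rightarrow> int \<times> ('t, 'g) op_elem) \<Rightarrow> bool"
  where "unital_additive_section tp s \<longleftrightarrow>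
     s \<in> hom (add_monoid (R_im tp)) (add_monoid (A_ring tp)) \<and>
     (\<forall>r\<in>carrier (R_im tp). reg_rep_hat tp (s r) = r) \<and> s \<one>\<^bsub>R_im tp\<^esub> = \<one>\<^bsub>A_ring tp\<^esub>"

definition section_cocycle ::
  "('t::ab_group_add \<Rightarrow> 'g::ab_group_add \<Rightarrow> 't \<Rightarrow> 'g \<Rightarrow> 't \<Rightarrow> 't)
     \<Rightarrow> (('t \<Rightarrow> 't) \<Rightarrow> int \<times> ('t, 'g) op_elem) \<Rightarrow> ('t \<Rightarrow> 't) list \<Rightarrow> int \<times> ('t, 'g) op_elem"
  where "section_cocycle tp s = (\<lambda>xs\<in>tuples (R_im tp) 2.
     s (xs ! 0) \<otimes>\<^bsub>A_ring tp\<^esub> s (xs ! 1) \<ominus>\<^bsub>A_ring tp\<^esub> s (xs ! 0 \<otimes>\<^bsub>R_im tp\<^esub> xs ! 1))"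

text \<open>The class is independent of the section, so it is the unique class arising from one.\<close>

definition regular_extension_class ::
  "('t::ab_group_add \<Rightarrow> 'g::ab_group_add \<Rightarrow> 't \<Rightarrow> 'g \<Rightarrow> 't \<Rightarrow> 't)
     \<Rightarrow> (('t \<Rightarrow> 't) list \<Rightarrow> int \<times> ('t, 'g) op_elem) set"
  where "regular_extension_class tp = (THE c. \<exists>s. unital_additive_section tp s \<and>
     c = hh_class (R_im tp) (K_bimodule tp) 2 (section_cocycle tp s))"


section \<open>The example \<open>T = \<int>e \<oplus> \<int>f\<close>, \<open>\<Gamma> = \<int>\<close>\<close>

definition e_T :: "int \<times> int" where "e_T = (1, 0)"
definition f_T :: "int \<times> int" where "f_T = (0, 1)"

definition int_scale :: "int \<Rightarrow> int \<times> int \<Rightarrow> int \<times> int"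
  where "int_scale k x = (k * fst x, k * snd x)"

definition bracket :: "int \<times> int \<Rightarrow> int \<times> int \<Rightarrow> int \<times> int \<Rightarrow> int \<times> int"
  where "bracket x y z = int_scale (fst x * fst y * fst z) f_T"

text \<open>This is the trilinear bracket with the prescribed values on the basis.\<close>

lemma bracket_trilinear:
  "additive (\<lambda>x. bracket x y z)" "additive (\<lambda>y. bracket x y z)" "additive (\<lambda>z. bracket x y z)"
  by (unfold_locales; simp add: bracket_def int_scale_def f_T_def algebra_simps)+

lemma bracket_basis:
  "bracket e_T e_T e_T = f_T"
  "\<lbrakk>x \<in> {e_T, f_T}; y \<in> {e_T, f_T}; z \<in> {e_T, f_T}; (x, y, z) \<noteq> (e_T, e_T, e_T)\<rbrakk> \<Longrightarrow> bracket x y z = 0"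
  by (auto simp: bracket_def int_scale_def e_T_def f_T_def zero_prod_def)

definition ex_tp :: "int \<times> int \<Rightarrow> int \<Rightarrow> int \<times> int \<Rightarrow> int \<Rightarrow> int \<times> int \<Rightarrow> int \<times> int"
  where "ex_tp x n y m z = int_scale (n * m) (bracket x y z)"

text \<open>Under \<open>F(T,\<int>) = T \<otimes> T\<close> the tensor \<open>x \<otimes> y\<close> is \<open>x \<otimes> 1 \<otimes> y \<otimes> 1\<close>.\<close>

definition p_ex :: "(int \<times> int, int) op_elem" where "p_ex = op_class ex_tp e_T 1 e_T 1"
definition q_ex :: "(int \<times> int, int) op_elem" where "q_ex = op_class ex_tp f_T 1 e_T 1"

definition ZX :: "(int, nat \<Rightarrow> int) up_ring" where "ZX = UP \<Z>"

definition X_pow :: "nat \<Rightarrow> nat \<Rightarrow> int" where "X_pow n = UnivPoly.monom ZX 1 n"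

definition X_ideal :: "nat \<Rightarrow> (nat \<Rightarrow> int) set" where "X_ideal n = Idl\<^bsub>ZX\<^esub> {X_pow n}"

end

(*
The class of a quadruple (a, alpha, b, beta) in O(T,Z) is the integer combination of p and q whose
coefficients are the weights alpha * beta * a_e * b_e and alpha * beta * (a_e * b_f + a_f * b_e). These
weights vanish on the tensor relations and on the ideal of associativity relations, so they are
coordinates on O(T,Z). In these coordinates A(T,Z) consists of triples (k, m, n) = k + m p + n q
multiplied as polynomials truncated at degree 3, and the regular representation forgets n. Every
unital additive section is (k, m) |-> (k, m, m t), and all of them have the same cocycle
((k, m), (k', m')) |-> m m' q. It takes the value q at the pair (p, p), whereas a coboundary dg takes
there the value p g(p) - g(p^2) + g(p) p = 0, because p acts as zero on K and p^2 = 0 in R_T.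
*)

theory Submission
  imports Defs
begin

section \<open>Quotients of rings without unit\<close>

text \<open>F and O need not have a unit, so their quotients are built for additive groups with a
  distributive product, where distributivity and absorption make the product of cosets well defined.
  T \<otimes> T is free on the four tensors of e and f. Associativity on basis elements identifies f
  \<otimes> e with e \<otimes> f, kills f \<otimes> f, and gives nothing else; this is the origin of
  the symmetric second weight. These two relations show that p and q span, but a presentation never
  shows by itself that generators are independent, hence the need for functionals. The regular
  representation, the actions on K and the extension class are definite descriptions, so each
  requires existence and uniqueness before it can be computed. The ring axioms of A are carried over
  from Z[X] along truncation. As all sections have equal cocycles, no two different cohomologous
  cocycles ever have to be compared.\<close>

locale distributive_magma = abelian_group R for R (structure) +
  assumes mult_closed: "\<lbrakk>x \<in> carrier R; y \<in> carrier R\<rbrakk> \<Longrightarrow> x \<otimes> y \<in> carrier R"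
    and mult_distrib_right: "\<lbrakk>x \<in> carrier R; y \<in> carrier R; z \<in> carrier R\<rbrakk> \<Longrightarrow> (x \<oplus> y) \<otimes> z = x \<otimes> z \<oplus> y \<otimes> z"
    and mult_distrib_left: "\<lbrakk>x \<in> carrier R; y \<in> carrier R; z \<in> carrier R\<rbrakk> \<Longrightarrow> z \<otimes> (x \<oplus> y) = z \<otimes> x \<oplus> z \<otimes> y"

locale distributive_magma_ideal = distributive_magma R for I and R (structure) +
  assumes rng_ideal: "rng_ideal I R"

sublocale distributive_magma_ideal \<subseteq> abelian_subgroup I R
  using rng_ideal abelian_group_axioms by (intro abelian_subgroupI3) (auto simp: rng_ideal_def)

context distributive_magma_ideal
begin

lemma absorb_left: "\<lbrakk>a \<in> I; x \<in> carrier R\<rbrakk> \<Longrightarrow> x \<otimes> a \<in> I"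
  and absorb_right: "\<lbrakk>a \<in> I; x \<in> carrier R\<rbrakk> \<Longrightarrow> a \<otimes> x \<in> I"
  using rng_ideal by (auto simp: rng_ideal_def)

lemma carrier_Quot: "carrier (R Quot I) = (\<lambda>x. I +> x) ` carrier R"
  by (auto simp: FactRing_def A_RCOSETS_def')

lemma Quot_add: "\<lbrakk>x \<in> carrier R; y \<in> carrier R\<rbrakk> \<Longrightarrow> (I +> x) \<oplus>\<^bsub>R Quot I\<^esub> (I +> y) = I +> (x \<oplus> y)"
  by (simp add: FactRing_def a_rcos_sum)

lemma coset_eq_iff:
  assumes "x \<in> carrier R" "y \<in> carrier R"
  shows "I +> x = I +> y \<longleftrightarrow> x \<ominus> y \<in> I"
proof -
  have "I +> x = I +> y \<longleftrightarrow> x \<in> I +> y"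
    using a_rcos_self[OF assms(1)] a_repr_independence'[of x y] assms(2) by auto
  then show ?thesis
    using a_rcos_module[OF assms(2,1)] assms by (simp add: minus_eq)
qed

text \<open>The quotient product is the union of the cosets of \<open>a \<otimes> b\<close> over all
  representatives, so it is one coset only if these all agree. For \<open>a = h \<oplus> x\<close>
  and \<open>b = k \<oplus> y\<close> the error terms \<open>h \<otimes> k\<close>,
  \<open>h \<otimes> y\<close>, \<open>x \<otimes> k\<close> are absorbed by
  \<open>I\<close>.\<close>

lemma Quot_mult:
  assumes x: "x \<in> carrier R" and y: "y \<in> carrier R"
  shows "(I +> x) \<otimes>\<^bsub>R Quot I\<^esub> (I +> y) = I +> (x \<otimes> y)"
proof -
  have eq: "I +> (a \<otimes> b) = I +> (x \<otimes> y)" if ab: "a \<in> I +> x" "b \<in> I +> y" for a b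
  proof -
    from ab obtain h k where h: "h \<in> I" "a = h \<oplus> x" and k: "k \<in> I" "b = k \<oplus> y"
      by (auto simp: a_r_coset_def')
    have c: "h \<in> carrier R" "k \<in> carrier R" using h k a_subset by auto
    have "a \<otimes> b = (h \<otimes> k \<oplus> h \<otimes> y \<oplus> x \<otimes> k) \<oplus> x \<otimes> y"
      using h k c x y
      by (simp add: mult_closed mult_distrib_left mult_distrib_right a_ac)
    moreover have "h \<otimes> k \<oplus> h \<otimes> y \<oplus> x \<otimes> k \<in> I"
      using h k c x y absorb_left absorb_right by (intro a_closed) auto
    ultimately have "a \<otimes> b \<in> I +> (x \<otimes> y)"
      by (auto simp: a_r_coset_def')
    then show ?thesis
      using a_repr_independence a_subgroup mult_closed x y by metis
  qed
  have "(I +> x) \<otimes>\<^bsub>R Quot I\<^esub> (I +> y) = (\<Union>a\<in>I +> x. \<Union>b\<in>I +> y. I +> a \<otimes> b)"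
    by (simp add: FactRing_def rcoset_mult_def)
  also have "\<dots> = (\<Union>a\<in>I +> x. \<Union>b\<in>I +> y. I +> x \<otimes> y)"
    by (intro SUP_cong refl eq)
  \<comment> \<open>A union over a constant family collapses because both index cosets are
    nonempty.\<close>
  also have "\<dots> = I +> x \<otimes> y"
    using a_rcos_self[OF x] a_rcos_self[OF y] by blast
  finally show ?thesis .
qed

lemma abelian_group_Quot: "abelian_group (R Quot I)"
proof -
  have "add_monoid (R Quot I) = R A_Mod I"
    by (simp add: FactRing_def A_FactGroup_def')
  then show ?thesis
    using a_factorgroup_is_comm_group by (intro comm_group_abelian_groupI) simp
qed

lemma distributive_magma_Quot: "distributive_magma (R Quot I)"
proof -
  interpret Q: abelian_group "R Quot I" by (rule abelian_group_Quot)
  show ?thesis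
    by unfold_locales
      (auto simp: carrier_Quot Quot_mult Quot_add mult_closed mult_distrib_left mult_distrib_right)
qed

end

lemma (in distributive_magma) rng_ideal_carrier: "rng_ideal (carrier R) R"
  using mult_closed by (auto simp: rng_ideal_def additive_subgroup_def add.subgroup_self)

lemma (in distributive_magma) rng_ideal_genideal:
  assumes "S \<subseteq> carrier R"
  shows "rng_ideal (rng_genideal R S) R"
proof -
  let ?C = "{I. rng_ideal I R \<and> S \<subseteq> I}"
  \<comment> \<open>The whole carrier is a member; an intersection over no ideals would be the whole
    type.\<close>
  have ne: "?C \<noteq> {}" using rng_ideal_carrier assms by auto
  have "subgroup (\<Inter>?C) (add_monoid R)"
    by (rule add.subgroups_Inter) (use ne in \<open>auto simp: rng_ideal_def additive_subgroup_def\<close>)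
  then show ?thesis
    by (auto simp: rng_ideal_def rng_genideal_def additive_subgroup_def)
qed

lemma rng_genideal_superset: "S \<subseteq> rng_genideal R S"
  by (auto simp: rng_genideal_def)

lemma rng_genideal_minimal: "\<lbrakk>rng_ideal I R; S \<subseteq> I\<rbrakk> \<Longrightarrow> rng_genideal R S \<subseteq> I"
  by (auto simp: rng_genideal_def)

text \<open>The integers are generated by 1. Families with an integer parameter, such as classes or
  operators in coordinates, are turned into integer multiples by this lemma.\<close>

lemma (in abelian_group) additive_int_map:
  assumes "\<And>n. f n \<in> carrier G" "\<And>m n. f (m + n) = f m \<oplus> f n"
  shows "f (n::int) = [n] \<cdot> f 1"
proof -
  have "f \<in> hom integer_group (add_monoid G)"
    using assms by (auto simp: hom_def)
  from hom_int_pow[OF this, of 1 n] show ?thesis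
    by (simp add: add_pow_def add.is_group)
qed

section \<open>The operator ring of a ternary Gamma-ring\<close>

lemmas frag_induct = frag_induction[OF subset_UNIV, simplified, case_names zero one diff]

section \<open>The product on formal sums of quadruples, for an arbitrary \<open>tp\<close>\<close>

lemma quad_ring_simps [simp]:
  "carrier (quad_ring tp) = UNIV"
  "x \<oplus>\<^bsub>quad_ring tp\<^esub> y = x + y"
  "\<zero>\<^bsub>quad_ring tp\<^esub> = 0"
  by (simp_all add: quad_ring_def)

lemma quad_ring_mult:
  "x \<otimes>\<^bsub>quad_ring tp\<^esub> y = frag_extend (\<lambda>(a, \<alpha>, b, \<beta>).
     frag_extend (\<lambda>(c, \<gamma>, d, \<delta>). frag_of (tp a \<alpha> b \<beta> c, \<gamma>, d, \<delta>)) y) x"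
  by (simp add: quad_ring_def)

lemma quad_ring_mult_frag_of:
  "frag_of (a, \<alpha>, b, \<beta>) \<otimes>\<^bsub>quad_ring tp\<^esub> frag_of (c, \<gamma>, d, \<delta>) = frag_of (tp a \<alpha> b \<beta> c, \<gamma>, d, \<delta>)"
  by (simp add: quad_ring_mult)

lemma abelian_group_quad_ring: "abelian_group (quad_ring tp)"
  by (rule abelian_groupI) (auto simp: algebra_simps intro: exI[of _ "- _"])

lemma quad_ring_distrib_right:
  "(x + y) \<otimes>\<^bsub>quad_ring tp\<^esub> z = x \<otimes>\<^bsub>quad_ring tp\<^esub> z + y \<otimes>\<^bsub>quad_ring tp\<^esub> z"
  by (simp add: quad_ring_mult frag_extend_add)

text \<open>The right factor sits inside the outer \<open>frag_extend\<close>, so its additivity is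
  reached by induction on the left factor.\<close>

lemma quad_ring_distrib_left:
  "z \<otimes>\<^bsub>quad_ring tp\<^esub> (x + y) = z \<otimes>\<^bsub>quad_ring tp\<^esub> x + z \<otimes>\<^bsub>quad_ring tp\<^esub> y"
proof (induction z rule: frag_induct)
  case (diff a b)
  then show ?case
    by (simp add: quad_ring_mult frag_extend_diff)
qed (auto simp: quad_ring_mult frag_extend_add)

interpretation quad: distributive_magma "quad_ring tp"
  using abelian_group_quad_ring[of tp]
  by (simp add: distributive_magma_def distributive_magma_axioms_def quad_ring_distrib_right
      quad_ring_distrib_left)

lemma quad_ring_uminus [simp]: "\<ominus>\<^bsub>quad_ring tp\<^esub> x = - x"
  by (rule quad.minus_equality) auto

lemma quad_ring_minus [simp]: "x \<ominus>\<^bsub>quad_ring tp\<^esub> y = x - y"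
  by (simp add: a_minus_def)

lemma quad_ring_mult_diff:
  "(x - y) \<otimes>\<^bsub>quad_ring tp\<^esub> z = x \<otimes>\<^bsub>quad_ring tp\<^esub> z - y \<otimes>\<^bsub>quad_ring tp\<^esub> z"
  "z \<otimes>\<^bsub>quad_ring tp\<^esub> (x - y) = z \<otimes>\<^bsub>quad_ring tp\<^esub> x - z \<otimes>\<^bsub>quad_ring tp\<^esub> y"
  using quad_ring_distrib_right[of tp "x - y" y z] quad_ring_distrib_left[of tp z "x - y" y]
  by (simp_all add: algebra_simps)

lemma quad_ring_mult_zero:
  "0 \<otimes>\<^bsub>quad_ring tp\<^esub> z = 0" "z \<otimes>\<^bsub>quad_ring tp\<^esub> 0 = 0"
  using quad_ring_mult_diff(1)[of tp 0 0 z] quad_ring_mult_diff(2)[of tp z 0 0] by simp_all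

section \<open>Tensor relations and the subgroup they generate\<close>

lemma tensor_relatorI:
  "frag_of (a + a', \<alpha>, b, \<beta>) - frag_of (a, \<alpha>, b, \<beta>) - frag_of (a', \<alpha>, b, \<beta>) \<in> tensor_relators"
  "frag_of (a, \<alpha> + \<alpha>', b, \<beta>) - frag_of (a, \<alpha>, b, \<beta>) - frag_of (a, \<alpha>', b, \<beta>) \<in> tensor_relators"
  "frag_of (a, \<alpha>, b + b', \<beta>) - frag_of (a, \<alpha>, b, \<beta>) - frag_of (a, \<alpha>, b', \<beta>) \<in> tensor_relators"
  "frag_of (a, \<alpha>, b, \<beta> + \<beta>') - frag_of (a, \<alpha>, b, \<beta>) - frag_of (a, \<alpha>, b, \<beta>') \<in> tensor_relators"
  unfolding tensor_relators_def by blast+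

lemma tensor_relator_cases [consumes 1, case_names add1 add2 add3 add4]:
  assumes "r \<in> tensor_relators"
  obtains a a' \<alpha> b \<beta> where "r = frag_of (a + a', \<alpha>, b, \<beta>) - frag_of (a, \<alpha>, b, \<beta>) - frag_of (a', \<alpha>, b, \<beta>)"
    | a \<alpha> \<alpha>' b \<beta> where "r = frag_of (a, \<alpha> + \<alpha>', b, \<beta>) - frag_of (a, \<alpha>, b, \<beta>) - frag_of (a, \<alpha>', b, \<beta>)"
    | a \<alpha> b b' \<beta> where "r = frag_of (a, \<alpha>, b + b', \<beta>) - frag_of (a, \<alpha>, b, \<beta>) - frag_of (a, \<alpha>, b', \<beta>)"
    | a \<alpha> b \<beta> \<beta>' where "r = frag_of (a, \<alpha>, b, \<beta> + \<beta>') - frag_of (a, \<alpha>, b, \<beta>) - frag_of (a, \<alpha>, b, \<beta>')"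
  using assms unfolding tensor_relators_def Un_iff mem_Collect_eq
  by (elim disjE exE conjE) (erule that)+

lemma tensor_relators_in_kernel: "r \<in> tensor_relators \<Longrightarrow> r \<in> tensor_kernel tp"
  by (simp add: tensor_kernel_def generate.incl)

lemma subgroup_tensor_kernel: "subgroup (tensor_kernel tp) (add_monoid (quad_ring tp))"
  unfolding tensor_kernel_def by (rule quad.add.generate_is_subgroup) simp

lemma tensor_kernel_closed:
  shows tensor_kernel_zero: "0 \<in> tensor_kernel tp"
    and tensor_kernel_add: "\<lbrakk>x \<in> tensor_kernel tp; y \<in> tensor_kernel tp\<rbrakk> \<Longrightarrow> x + y \<in> tensor_kernel tp"
    and tensor_kernel_uminus: "x \<in> tensor_kernel tp \<Longrightarrow> - x \<in> tensor_kernel tp"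
    and tensor_kernel_diff: "\<lbrakk>x \<in> tensor_kernel tp; y \<in> tensor_kernel tp\<rbrakk> \<Longrightarrow> x - y \<in> tensor_kernel tp"
proof -
  interpret additive_subgroup "tensor_kernel tp" "quad_ring tp"
    by (intro additive_subgroupI subgroup_tensor_kernel)
  show 0: "0 \<in> tensor_kernel tp" using zero_closed by simp
  show 1: "\<lbrakk>x \<in> tensor_kernel tp; y \<in> tensor_kernel tp\<rbrakk> \<Longrightarrow> x + y \<in> tensor_kernel tp" for x y
    using a_closed[of x y] by simp
  show 2: "x \<in> tensor_kernel tp \<Longrightarrow> - x \<in> tensor_kernel tp" for x
    using a_inv_closed[of x] by simp
  show "\<lbrakk>x \<in> tensor_kernel tp; y \<in> tensor_kernel tp\<rbrakk> \<Longrightarrow> x - y \<in> tensor_kernel tp"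
    using 1[of x "- y"] 2[of y] by simp
qed

text \<open>Differences cover both inverses and sums, since - y = 0 - y and x + y = x - (- y). The
  single closure case matches the shape of \<open>frag_induct\<close>.\<close>

lemma tensor_kernel_induct [consumes 1, case_names zero relator diff]:
  assumes "x \<in> tensor_kernel tp" "P 0" "\<And>r. r \<in> tensor_relators \<Longrightarrow> P r"
    "\<And>x y. \<lbrakk>P x; P y\<rbrakk> \<Longrightarrow> P (x - y)"
  shows "P x"
proof -
  have neg: "P (- y)" if "P y" for y
    using assms(4)[OF assms(2) that] by simp
  have "x \<in> generate (add_monoid (quad_ring tp)) tensor_relators"
    using assms(1) by (simp add: tensor_kernel_def)
  then show ?thesis
  proof (induction rule: generate.induct)
    case one
    then show ?case using assms(2) by simp
  next
    case (incl h)
    then show ?case by (rule assms(3))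
  next
    case (inv h)
    have "inv\<^bsub>add_monoid (quad_ring tp)\<^esub> h = - h"
      using quad_ring_uminus[of tp h] by (simp only: a_inv_def)
    then show ?case using neg assms(3)[OF inv] by simp
  next
    case (eng h1 h2)
    have "P (h1 - - h2)"
      using assms(4)[OF eng.IH(1) neg[OF eng.IH(2)]] .
    then show ?case by simp
  qed
qed

section \<open>Passage from formal sums to \<open>F_ring\<close> and \<open>O_ring\<close>\<close>

context ternary_gamma_ring
begin

text \<open>Multiplying a relator on the right by a generator feeds all four of its slots into
  \<open>tp\<close>, which is additive in each, so every kind of relator becomes one of the first
  kind.\<close>

lemma tensor_kernel_mult_right:
  assumes "x \<in> tensor_kernel tp"
  shows "x \<otimes>\<^bsub>quad_ring tp\<^esub> y \<in> tensor_kernel tp"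
  using assms
proof (induction x rule: tensor_kernel_induct)
  case (relator r)
  show ?case
  proof (induction y rule: frag_induct)
    case (one x)
    obtain c \<gamma> d \<delta> where x: "x = (c, \<gamma>, d, \<delta>)" by (cases x)
    have "r \<otimes>\<^bsub>quad_ring tp\<^esub> frag_of x \<in> tensor_relators"
      using relator
      by (cases rule: tensor_relator_cases)
        (simp_all add: x quad_ring_mult_diff quad_ring_mult_frag_of add1 add2 add3 add4 tensor_relatorI(1))
    then show ?case by (rule tensor_relators_in_kernel)
  qed (auto simp: quad_ring_mult_diff quad_ring_mult_zero intro: tensor_kernel_closed)
qed (auto simp: quad_ring_mult_diff quad_ring_mult_zero intro: tensor_kernel_closed)

text \<open>Here only the first slot of the relator enters \<open>tp\<close>, through its last
  argument; the other three slots are kept, so each relator goes to one of the same kind.\<close>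

lemma tensor_kernel_mult_left:
  assumes "x \<in> tensor_kernel tp"
  shows "y \<otimes>\<^bsub>quad_ring tp\<^esub> x \<in> tensor_kernel tp"
  using assms
proof (induction x rule: tensor_kernel_induct)
  case (relator r)
  show ?case
  proof (induction y rule: frag_induct)
    case (one x)
    obtain a \<alpha> b \<beta> where x: "x = (a, \<alpha>, b, \<beta>)" by (cases x)
    have "frag_of x \<otimes>\<^bsub>quad_ring tp\<^esub> r \<in> tensor_relators"
      using relator
      by (cases rule: tensor_relator_cases)
        (simp_all add: x quad_ring_mult_diff quad_ring_mult_frag_of add5 tensor_relatorI)
    then show ?case by (rule tensor_relators_in_kernel)
  qed (auto simp: quad_ring_mult_diff quad_ring_mult_zero intro: tensor_kernel_closed)
qed (auto simp: quad_ring_mult_diff quad_ring_mult_zero intro: tensor_kernel_closed)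

sublocale tensor: distributive_magma_ideal "tensor_kernel tp" "quad_ring tp"
proof unfold_locales
  have "additive_subgroup (tensor_kernel tp) (quad_ring tp)"
    by (intro additive_subgroupI subgroup_tensor_kernel)
  then show "rng_ideal (tensor_kernel tp) (quad_ring tp)"
    by (simp add: rng_ideal_def tensor_kernel_mult_left tensor_kernel_mult_right)
qed

sublocale F: distributive_magma "F_ring tp"
  unfolding F_ring_def by (rule tensor.distributive_magma_Quot)

definition tensor_class :: "(('t \<times> 'g \<times> 't \<times> 'g) \<Rightarrow>\<^sub>0 int) \<Rightarrow> (('t \<times> 'g \<times> 't \<times> 'g) \<Rightarrow>\<^sub>0 int) set"
  where "tensor_class x = tensor_kernel tp +>\<^bsub>quad_ring tp\<^esub> x"

lemma pure_tensor_eq: "pure_tensor tp a \<alpha> b \<beta> = tensor_class (frag_of (a, \<alpha>, b, \<beta>))"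
  by (simp add: pure_tensor_def tensor_class_def)

lemma carrier_F_ring: "carrier (F_ring tp) = range tensor_class"
  by (simp add: F_ring_def tensor.carrier_Quot tensor_class_def[abs_def])

lemma tensor_class_closed [simp]: "tensor_class x \<in> carrier (F_ring tp)"
  by (simp add: carrier_F_ring)

lemma tensor_class_add: "tensor_class (x + y) = tensor_class x \<oplus>\<^bsub>F_ring tp\<^esub> tensor_class y"
  using tensor.Quot_add[of x y] by (simp add: F_ring_def tensor_class_def)

lemma tensor_class_mult:
  "tensor_class (x \<otimes>\<^bsub>quad_ring tp\<^esub> y) = tensor_class x \<otimes>\<^bsub>F_ring tp\<^esub> tensor_class y"
  using tensor.Quot_mult[of x y] by (simp add: F_ring_def tensor_class_def)

lemma tensor_class_eq_iff: "tensor_class x = tensor_class y \<longleftrightarrow> x - y \<in> tensor_kernel tp"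
  using tensor.coset_eq_iff[of x y] by (simp add: tensor_class_def)

lemma tensor_class_diff: "tensor_class (x - y) = tensor_class x \<ominus>\<^bsub>F_ring tp\<^esub> tensor_class y"
proof -
  have "tensor_class x = tensor_class (x - y) \<oplus>\<^bsub>F_ring tp\<^esub> tensor_class y"
    by (simp flip: tensor_class_add)
  then show ?thesis
    by (simp add: F.minus_eq F.a_assoc F.r_neg)
qed

definition assoc_relators :: "(('t \<times> 'g \<times> 't \<times> 'g) \<Rightarrow>\<^sub>0 int) set set"
  where "assoc_relators =
    {pure_tensor tp (tp a \<alpha> b \<beta> c) \<gamma> d \<delta> \<ominus>\<^bsub>F_ring tp\<^esub> pure_tensor tp a \<alpha> (tp b \<beta> c \<gamma> d) \<delta>
        | a \<alpha> b \<beta> c \<gamma> d \<delta>. True}"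

lemma assoc_ideal_eq: "assoc_ideal tp = rng_genideal (F_ring tp) assoc_relators"
  by (simp add: assoc_ideal_def assoc_relators_def)

sublocale assoc: distributive_magma_ideal "assoc_ideal tp" "F_ring tp"
proof unfold_locales
  have "assoc_relators \<subseteq> carrier (F_ring tp)"
    by (auto simp: assoc_relators_def pure_tensor_eq simp flip: tensor_class_diff)
  then show "rng_ideal (assoc_ideal tp) (F_ring tp)"
    unfolding assoc_ideal_eq by (rule F.rng_ideal_genideal)
qed

sublocale O: distributive_magma "O_ring tp"
  unfolding O_ring_def by (rule assoc.distributive_magma_Quot)

text \<open>The composite surjection from formal sums onto O. Identities in O are checked on formal
  sums instead of on cosets of cosets.\<close>

definition frag_class :: "(('t \<times> 'g \<times> 't \<times> 'g) \<Rightarrow>\<^sub>0 int) \<Rightarrow> ('t, 'g) op_elem"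
  where "frag_class x = assoc_ideal tp +>\<^bsub>F_ring tp\<^esub> tensor_class x"

lemma op_class_eq: "op_class tp a \<alpha> b \<beta> = frag_class (frag_of (a, \<alpha>, b, \<beta>))"
  by (simp add: op_class_def frag_class_def pure_tensor_eq)

lemma carrier_O_ring: "carrier (O_ring tp) = range frag_class"
  by (auto simp: O_ring_def assoc.carrier_Quot carrier_F_ring frag_class_def)

lemma frag_class_closed [simp]: "frag_class x \<in> carrier (O_ring tp)"
  by (simp add: carrier_O_ring)

lemma op_class_closed [simp]: "op_class tp a \<alpha> b \<beta> \<in> carrier (O_ring tp)"
  by (simp add: op_class_eq)

lemma frag_class_add: "frag_class (x + y) = frag_class x \<oplus>\<^bsub>O_ring tp\<^esub> frag_class y"
  by (simp add: O_ring_def frag_class_def assoc.Quot_add tensor_class_add)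

lemma frag_class_mult:
  "frag_class (x \<otimes>\<^bsub>quad_ring tp\<^esub> y) = frag_class x \<otimes>\<^bsub>O_ring tp\<^esub> frag_class y"
  by (simp add: O_ring_def frag_class_def assoc.Quot_mult tensor_class_mult)

lemma frag_class_eq_iff: "frag_class x = frag_class y \<longleftrightarrow> tensor_class (x - y) \<in> assoc_ideal tp"
  by (simp add: frag_class_def assoc.coset_eq_iff tensor_class_diff)

lemma frag_class_diff: "frag_class (x - y) = frag_class x \<ominus>\<^bsub>O_ring tp\<^esub> frag_class y"
proof -
  have "frag_class x = frag_class (x - y) \<oplus>\<^bsub>O_ring tp\<^esub> frag_class y"
    by (simp flip: frag_class_add)
  then show ?thesis
    by (simp add: O.minus_eq O.a_assoc O.r_neg)
qed

lemma frag_class_zero: "frag_class 0 = \<zero>\<^bsub>O_ring tp\<^esub>"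
  using frag_class_diff[of 0 0] by (simp add: O.minus_eq O.r_neg)

lemma frag_class_tensor_kernel: "x - y \<in> tensor_kernel tp \<Longrightarrow> frag_class x = frag_class y"
  by (simp add: frag_class_def tensor_class_eq_iff[THEN iffD2])

lemma op_class_add:
  "op_class tp (a + a') \<alpha> b \<beta> = op_class tp a \<alpha> b \<beta> \<oplus>\<^bsub>O_ring tp\<^esub> op_class tp a' \<alpha> b \<beta>"
  "op_class tp a (\<alpha> + \<alpha>') b \<beta> = op_class tp a \<alpha> b \<beta> \<oplus>\<^bsub>O_ring tp\<^esub> op_class tp a \<alpha>' b \<beta>"
  "op_class tp a \<alpha> (b + b') \<beta> = op_class tp a \<alpha> b \<beta> \<oplus>\<^bsub>O_ring tp\<^esub> op_class tp a \<alpha> b' \<beta>"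
  "op_class tp a \<alpha> b (\<beta> + \<beta>') = op_class tp a \<alpha> b \<beta> \<oplus>\<^bsub>O_ring tp\<^esub> op_class tp a \<alpha> b \<beta>'"
  unfolding op_class_eq frag_class_add[symmetric]
  by (rule frag_class_tensor_kernel, rule tensor_relators_in_kernel,
      unfold diff_diff_eq[symmetric], rule tensor_relatorI)+

lemma op_class_assoc: "op_class tp (tp a \<alpha> b \<beta> c) \<gamma> d \<delta> = op_class tp a \<alpha> (tp b \<beta> c \<gamma> d) \<delta>"
proof -
  have "tensor_class (frag_of (tp a \<alpha> b \<beta> c, \<gamma>, d, \<delta>) - frag_of (a, \<alpha>, tp b \<beta> c \<gamma> d, \<delta>)) \<in> assoc_relators"
    unfolding tensor_class_diff assoc_relators_def pure_tensor_eq by blast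
  then show ?thesis
    unfolding op_class_eq frag_class_eq_iff assoc_ideal_eq
    by (rule subsetD[OF rng_genideal_superset])
qed

end

section \<open>The operator ring of the example\<close>

text \<open>The linear functional with values \<open>w\<close> on generators. Since
  \<open>frag_extend\<close> maps into a free abelian group, the integers are encoded as formal sums
  over the one-element type and read off at \<open>()\<close>.\<close>

definition frag_weight :: "('a \<Rightarrow> int) \<Rightarrow> ('a \<Rightarrow>\<^sub>0 int) \<Rightarrow> int"
  where "frag_weight w x = poly_mapping.lookup (frag_extend (\<lambda>i. frag_cmul (w i) (frag_of ())) x) ()"

lemma frag_weight_simps [simp]:
  "frag_weight w 0 = 0"
  "frag_weight w (frag_of i) = w i"
  "frag_weight w (x + y) = frag_weight w x + frag_weight w y"
  "frag_weight w (- x) = - frag_weight w x"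
  "frag_weight w (x - y) = frag_weight w x - frag_weight w y"
  by (simp_all add: frag_weight_def frag_extend_add frag_extend_diff frag_extend_minus
      lookup_add lookup_minus)

text \<open>Products are multiples of f and depend on e-coordinates only, so every nested product
  vanishes and both associativity laws read 0 = 0.\<close>

lemma ternary_gamma_ring_ex: "ternary_gamma_ring ex_tp"
  by unfold_locales
    (simp_all add: ex_tp_def bracket_def int_scale_def f_T_def algebra_simps)

interpretation ex: ternary_gamma_ring ex_tp
  by (rule ternary_gamma_ring_ex)

lemma ex_tp_eq: "ex_tp x n y m z = (0, n * m * (fst x * fst y * fst z))"
  by (simp add: ex_tp_def bracket_def int_scale_def f_T_def)

abbreviation ex_class :: "int \<times> int \<Rightarrow> int \<Rightarrow> int \<times> int \<Rightarrow> int \<Rightarrow> (int \<times> int, int) op_elem"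
  where "ex_class \<equiv> op_class ex_tp"

abbreviation ex_O :: "(int \<times> int, int) op_elem ring"
  where "ex_O \<equiv> O_ring ex_tp"

lemma ex_class_zero:
  "ex_class 0 \<alpha> b \<beta> = \<zero>\<^bsub>ex_O\<^esub>" "ex_class a \<alpha> 0 \<beta> = \<zero>\<^bsub>ex_O\<^esub>"
  using ex.op_class_add(1)[of 0 0 \<alpha> b \<beta>] ex.op_class_add(3)[of a \<alpha> 0 0 \<beta>] by simp_all

lemma ex_class_expand:
  "ex_class a \<alpha> b \<beta> = add_pow ex_O (fst a) (ex_class e_T \<alpha> b \<beta>) \<oplus>\<^bsub>ex_O\<^esub> add_pow ex_O (snd a) (ex_class f_T \<alpha> b \<beta>)"
  "ex_class a \<alpha> b \<beta> = add_pow ex_O (fst b) (ex_class a \<alpha> e_T \<beta>) \<oplus>\<^bsub>ex_O\<^esub> add_pow ex_O (snd b) (ex_class a \<alpha> f_T \<beta>)"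
  "ex_class a \<alpha> b \<beta> = add_pow ex_O \<alpha> (ex_class a 1 b \<beta>)"
  "ex_class a \<alpha> b \<beta> = add_pow ex_O \<beta> (ex_class a \<alpha> b 1)"
proof -
  have "ex_class (n, 0) \<alpha> b \<beta> = add_pow ex_O n (ex_class e_T \<alpha> b \<beta>)" for n
    using ex.op_class_add(1)[of "(_, 0)" "(_, 0)"]
    by (subst ex.O.additive_int_map[of "\<lambda>n. ex_class (n, 0) \<alpha> b \<beta>"]) (auto simp: e_T_def)
  moreover have "ex_class (0, n) \<alpha> b \<beta> = add_pow ex_O n (ex_class f_T \<alpha> b \<beta>)" for n
    using ex.op_class_add(1)[of "(0, _)" "(0, _)"]
    by (subst ex.O.additive_int_map[of "\<lambda>n. ex_class (0, n) \<alpha> b \<beta>"]) (auto simp: f_T_def)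
  ultimately show "ex_class a \<alpha> b \<beta> = add_pow ex_O (fst a) (ex_class e_T \<alpha> b \<beta>) \<oplus>\<^bsub>ex_O\<^esub> add_pow ex_O (snd a) (ex_class f_T \<alpha> b \<beta>)"
    using ex.op_class_add(1)[of "(fst a, 0)" "(0, snd a)" \<alpha> b \<beta>] by simp
  have "ex_class a \<alpha> (n, 0) \<beta> = add_pow ex_O n (ex_class a \<alpha> e_T \<beta>)" for n
    using ex.op_class_add(3)[of _ _ "(_, 0)" "(_, 0)"]
    by (subst ex.O.additive_int_map[of "\<lambda>n. ex_class a \<alpha> (n, 0) \<beta>"]) (auto simp: e_T_def)
  moreover have "ex_class a \<alpha> (0, n) \<beta> = add_pow ex_O n (ex_class a \<alpha> f_T \<beta>)" for n
    using ex.op_class_add(3)[of _ _ "(0, _)" "(0, _)"]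
    by (subst ex.O.additive_int_map[of "\<lambda>n. ex_class a \<alpha> (0, n) \<beta>"]) (auto simp: f_T_def)
  ultimately show "ex_class a \<alpha> b \<beta> = add_pow ex_O (fst b) (ex_class a \<alpha> e_T \<beta>) \<oplus>\<^bsub>ex_O\<^esub> add_pow ex_O (snd b) (ex_class a \<alpha> f_T \<beta>)"
    using ex.op_class_add(3)[of a \<alpha> "(fst b, 0)" "(0, snd b)" \<beta>] by simp
  show "ex_class a \<alpha> b \<beta> = add_pow ex_O \<alpha> (ex_class a 1 b \<beta>)"
    by (rule ex.O.additive_int_map) (simp_all add: ex.op_class_add)
  show "ex_class a \<alpha> b \<beta> = add_pow ex_O \<beta> (ex_class a \<alpha> b 1)"
    by (rule ex.O.additive_int_map) (simp_all add: ex.op_class_add)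
qed

lemma add_pow_int_zero: "add_pow R (0::int) x = \<zero>\<^bsub>R\<^esub>"
  by (simp add: add_pow_def)

definition O_elem :: "int \<Rightarrow> int \<Rightarrow> (int \<times> int, int) op_elem"
  where "O_elem m n = add_pow ex_O m p_ex \<oplus>\<^bsub>ex_O\<^esub> add_pow ex_O n q_ex"

lemma p_q_closed [simp]: "p_ex \<in> carrier ex_O" "q_ex \<in> carrier ex_O"
  by (simp_all add: p_ex_def q_ex_def)

lemma O_elem_closed [simp]: "O_elem m n \<in> carrier ex_O"
  by (simp add: O_elem_def)

lemma O_elem_add: "O_elem m n \<oplus>\<^bsub>ex_O\<^esub> O_elem m' n' = O_elem (m + m') (n + n')"
  by (simp add: O_elem_def ex.O.add.int_pow_mult ex.O.a_ac)

lemma O_elem_add_pow: "add_pow ex_O (k::int) (O_elem m n) = O_elem (k * m) (k * n)"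
  by (simp add: O_elem_def ex.O.add.int_pow_distrib ex.O.add.int_pow_pow mult.commute)

lemma p_q_zero_O_elem:
  shows p_ex_O_elem: "p_ex = O_elem 1 0"
    and q_ex_O_elem: "q_ex = O_elem 0 1"
    and zero_O_elem: "\<zero>\<^bsub>ex_O\<^esub> = O_elem 0 0"
  by (simp_all add: O_elem_def add_pow_int_zero)

lemma O_elem_uminus: "\<ominus>\<^bsub>ex_O\<^esub> O_elem m n = O_elem (- m) (- n)"
  by (rule ex.O.minus_equality) (simp_all add: O_elem_add zero_O_elem)

lemma O_elem_minus: "O_elem m n \<ominus>\<^bsub>ex_O\<^esub> O_elem m' n' = O_elem (m - m') (n - n')"
  by (simp add: a_minus_def O_elem_uminus O_elem_add)

text \<open>Associativity at (e, e, e, e): bracketing the first three factors gives f \<otimes> e,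
  bracketing the last three gives e \<otimes> f.\<close>

lemma ex_class_e_f: "ex_class e_T 1 f_T 1 = q_ex"
  using ex.op_class_assoc[of e_T 1 e_T 1 e_T 1 e_T 1]
  by (simp add: q_ex_def ex_tp_eq e_T_def f_T_def)

text \<open>Associativity at (e, e, e, f): the first bracket gives f \<otimes> f, while the second
  is [e, e, f] = 0.\<close>

lemma ex_class_f_f: "ex_class f_T 1 f_T 1 = \<zero>\<^bsub>ex_O\<^esub>"
  using ex.op_class_assoc[of e_T 1 e_T 1 e_T 1 f_T 1] ex_class_zero(2)
  by (simp add: ex_tp_eq e_T_def f_T_def zero_prod_def)

fun p_weight :: "(int \<times> int) \<times> int \<times> (int \<times> int) \<times> int \<Rightarrow> int"
  where "p_weight (a, \<alpha>, b, \<beta>) = \<alpha> * \<beta> * (fst a * fst b)"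

text \<open>The coefficients of e \<otimes> f and f \<otimes> e are added because the two tensors
  have the same class; f \<otimes> f has class zero and gets weight zero.\<close>

fun q_weight :: "(int \<times> int) \<times> int \<times> (int \<times> int) \<times> int \<Rightarrow> int"
  where "q_weight (a, \<alpha>, b, \<beta>) = \<alpha> * \<beta> * (fst a * snd b + snd a * fst b)"

lemma ex_class_O_elem: "ex_class a \<alpha> b \<beta> = O_elem (p_weight (a, \<alpha>, b, \<beta>)) (q_weight (a, \<alpha>, b, \<beta>))"
proof -
  have *: "ex_class e_T 1 e_T 1 = O_elem 1 0" "ex_class f_T 1 e_T 1 = O_elem 0 1"
    by (simp_all flip: p_q_zero_O_elem add: p_ex_def q_ex_def)
  have "ex_class e_T 1 b 1 = O_elem (fst b) (snd b)" "ex_class f_T 1 b 1 = O_elem 0 (fst b)"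
    using ex_class_expand(2)[of e_T 1 b 1] ex_class_expand(2)[of f_T 1 b 1]
    by (simp_all add: * ex_class_e_f ex_class_f_f q_ex_O_elem zero_O_elem O_elem_add O_elem_add_pow)
  then have "ex_class a 1 b 1 = O_elem (fst a * fst b) (fst a * snd b + snd a * fst b)"
    using ex_class_expand(1)[of a 1 b 1] by (simp add: O_elem_add O_elem_add_pow)
  then show ?thesis
    using ex_class_expand(3)[of a \<alpha> b \<beta>] ex_class_expand(4)[of a 1 b \<beta>] by (simp add: O_elem_add_pow mult.assoc)
qed

text \<open>The spanning half of the description of O(T,Z), valid before p and q are known to be
  independent.\<close>

lemma frag_class_O_elem: "ex.frag_class x = O_elem (frag_weight p_weight x) (frag_weight q_weight x)"
proof (induction x rule: frag_induct)
  case (one i)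
  then show ?case
    by (cases i) (simp add: ex_class_O_elem flip: ex.op_class_eq)
qed (simp_all add: ex.frag_class_zero zero_O_elem ex.frag_class_diff O_elem_minus)

text \<open>Both weights are additive in each of the four slots, so they vanish on relators.\<close>

lemma tensor_kernel_weight:
  assumes "x \<in> tensor_kernel ex_tp"
  shows "frag_weight p_weight x = 0" "frag_weight q_weight x = 0"
proof -
  have "frag_weight p_weight x = 0 \<and> frag_weight q_weight x = 0"
    using assms
  proof (induction rule: tensor_kernel_induct)
    case (relator r)
    then show ?case
      by (cases rule: tensor_relator_cases) (simp_all add: ring_distribs)
  qed auto
  then show "frag_weight p_weight x = 0" "frag_weight q_weight x = 0" by simp_all
qed

text \<open>The first entry of a product of generators is a multiple of f. Its e-coordinate is zero,
  which kills the p-weight and leaves in the q-weight only the f-coordinate of the first entry times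
  the e-coordinate of the third.\<close>

lemma quad_ring_mult_weight:
  "frag_weight p_weight (x \<otimes>\<^bsub>quad_ring ex_tp\<^esub> y) = 0"
  "frag_weight q_weight (x \<otimes>\<^bsub>quad_ring ex_tp\<^esub> y) = frag_weight p_weight x * frag_weight p_weight y"
proof -
  have "frag_weight p_weight (x \<otimes>\<^bsub>quad_ring ex_tp\<^esub> y) = 0 \<and>
    frag_weight q_weight (x \<otimes>\<^bsub>quad_ring ex_tp\<^esub> y) = frag_weight p_weight x * frag_weight p_weight y"
  proof (induction x rule: frag_induct)
    case (one i)
    show ?case
    proof (induction y rule: frag_induct)
      case (one j)
      then show ?case
        by (cases i; cases j) (simp add: quad_ring_mult_frag_of ex_tp_eq)
    qed (auto simp: quad_ring_mult_zero quad_ring_mult_diff algebra_simps)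
  qed (auto simp: quad_ring_mult_zero quad_ring_mult_diff algebra_simps)
  then show "frag_weight p_weight (x \<otimes>\<^bsub>quad_ring ex_tp\<^esub> y) = 0"
    "frag_weight q_weight (x \<otimes>\<^bsub>quad_ring ex_tp\<^esub> y) = frag_weight p_weight x * frag_weight p_weight y"
    by simp_all
qed

text \<open>The common kernel of the two weights is an ideal containing the associativity relators, so the
  weights descend to \<open>\<O>(T,\<int>)\<close>; this is what shows \<open>p\<close> and \<open>q\<close> to be independent.\<close>

lemma assoc_ideal_weight:
  assumes "ex.tensor_class x \<in> assoc_ideal ex_tp"
  shows "frag_weight p_weight x = 0" "frag_weight q_weight x = 0"
proof -
  define J where "J = {ex.tensor_class x | x. frag_weight p_weight x = 0 \<and> frag_weight q_weight x = 0}"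
  \<comment> \<open>Membership in \<open>J\<close> does not depend on the representative, since the
    weights vanish on the tensor kernel.\<close>
  have J: "ex.tensor_class x \<in> J \<longleftrightarrow> frag_weight p_weight x = 0 \<and> frag_weight q_weight x = 0" for x
  proof
    assume "ex.tensor_class x \<in> J"
    then obtain y where "ex.tensor_class x = ex.tensor_class y"
      and y: "frag_weight p_weight y = 0" "frag_weight q_weight y = 0"
      by (auto simp: J_def)
    then have "x - y \<in> tensor_kernel ex_tp"
      by (simp add: ex.tensor_class_eq_iff)
    with tensor_kernel_weight[of "x - y"] y
    show "frag_weight p_weight x = 0 \<and> frag_weight q_weight x = 0" by simp
  qed (auto simp: J_def)
  have "subgroup J (add_monoid (F_ring ex_tp))"
  proof (rule ex.F.add.subgroupI)
    show "J \<subseteq> carrier (F_ring ex_tp)" by (auto simp: J_def)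
    show "J \<noteq> {}" using J[of 0] by auto
    fix a assume "a \<in> J"
    then obtain x where x: "a = ex.tensor_class x" by (auto simp: J_def)
    have "ex.tensor_class (0 - x) \<oplus>\<^bsub>F_ring ex_tp\<^esub> ex.tensor_class x = \<zero>\<^bsub>F_ring ex_tp\<^esub>"
      using ex.tensor_class_diff[of 0 0] by (simp add: ex.F.minus_eq ex.F.r_neg flip: ex.tensor_class_add)
    then have "\<ominus>\<^bsub>F_ring ex_tp\<^esub> a = ex.tensor_class (0 - x)"
      by (intro ex.F.minus_equality) (simp_all add: x)
    then show "\<ominus>\<^bsub>F_ring ex_tp\<^esub> a \<in> J" using \<open>a \<in> J\<close> unfolding x by (simp only: J) simp
    fix b assume "b \<in> J"
    then obtain y where y: "b = ex.tensor_class y" by (auto simp: J_def)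
    show "a \<oplus>\<^bsub>F_ring ex_tp\<^esub> b \<in> J"
      using \<open>a \<in> J\<close> \<open>b \<in> J\<close> unfolding x y ex.tensor_class_add[symmetric] by (simp add: J)
  qed
  moreover have "u \<otimes>\<^bsub>F_ring ex_tp\<^esub> a \<in> J \<and> a \<otimes>\<^bsub>F_ring ex_tp\<^esub> u \<in> J"
    if a: "a \<in> J" and u: "u \<in> carrier (F_ring ex_tp)" for a u
  proof -
    obtain x y where xy: "a = ex.tensor_class x" "u = ex.tensor_class y"
      using a u by (auto simp: J_def ex.carrier_F_ring)
    show ?thesis
      using a unfolding xy ex.tensor_class_mult[symmetric] by (simp add: J quad_ring_mult_weight)
  qed
  ultimately have "rng_ideal J (F_ring ex_tp)"
    by (simp add: rng_ideal_def additive_subgroup_def)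
  \<comment> \<open>Both sides of an associativity relation have p-weight zero, and q-weight the
    product of the four e-coordinates and the four scalars.\<close>
  moreover have "ex.assoc_relators \<subseteq> J"
    by (auto simp: ex.assoc_relators_def ex.pure_tensor_eq J ex_tp_eq algebra_simps simp flip: ex.tensor_class_diff)
  ultimately have "assoc_ideal ex_tp \<subseteq> J"
    unfolding ex.assoc_ideal_eq by (rule rng_genideal_minimal)
  then show "frag_weight p_weight x = 0" "frag_weight q_weight x = 0"
    using assms J by auto
qed

lemma O_elem_eq_iff [simp]: "O_elem m n = O_elem m' n' \<longleftrightarrow> m = m' \<and> n = n'"
proof
  assume eq: "O_elem m n = O_elem m' n'"
  \<comment> \<open>The single tensor (i e + j f) \<otimes> e already represents i p + j q.\<close>
  have "O_elem i j = ex.frag_class (frag_of ((i, j), 1, e_T, 1))" for i j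
    by (simp add: frag_class_O_elem e_T_def)
  with eq show "m = m' \<and> n = n'"
    using assoc_ideal_weight[of "frag_of ((m, n), 1, e_T, 1) - frag_of ((m', n'), 1, e_T, 1)"]
    by (simp add: ex.frag_class_eq_iff e_T_def)
qed simp

lemma O_elem_cases:
  assumes "u \<in> carrier ex_O"
  obtains m n where "u = O_elem m n"
  using assms by (auto simp: ex.carrier_O_ring frag_class_O_elem)

lemma carrier_ex_O: "carrier ex_O = range (case_prod O_elem)"
  by (auto elim: O_elem_cases)

lemma O_elem_mult: "O_elem m n \<otimes>\<^bsub>ex_O\<^esub> O_elem m' n' = O_elem 0 (m * m')"
proof -
  have *: "O_elem i j = ex.frag_class (frag_of ((i, j), 1, e_T, 1))" for i j
    by (simp add: frag_class_O_elem e_T_def)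
  have "O_elem m n \<otimes>\<^bsub>ex_O\<^esub> O_elem m' n' =
      ex.frag_class (frag_of ((m, n), 1, e_T, 1) \<otimes>\<^bsub>quad_ring ex_tp\<^esub> frag_of ((m', n'), 1, e_T, 1))"
    unfolding * by (rule ex.frag_class_mult[symmetric])
  then show ?thesis
    by (simp add: frag_class_O_elem quad_ring_mult_weight e_T_def)
qed

lemma O_elem_iso:
  "(\<lambda>(m, n). O_elem m n) \<in> iso (integer_group \<times>\<times> integer_group) (add_monoid ex_O)"
  by (auto simp: iso_def hom_def bij_betw_def inj_on_def carrier_ex_O O_elem_add)

section \<open>The regular representation of the example\<close>

lemma End_ring_simps [simp]:
  "carrier End_ring = {h. additive h}"
  "g \<oplus>\<^bsub>End_ring\<^esub> h = (\<lambda>x. g x + h x)"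
  "g \<otimes>\<^bsub>End_ring\<^esub> h = g \<circ> h"
  "\<zero>\<^bsub>End_ring\<^esub> = (\<lambda>_. 0)"
  "\<one>\<^bsub>End_ring\<^esub> = id"
  by (simp_all add: End_ring_def)

lemma abelian_group_End_ring: "abelian_group (End_ring :: ('t::ab_group_add \<Rightarrow> 't) ring)"
proof (rule abelian_groupI)
  fix h :: "'t \<Rightarrow> 't"
  assume "h \<in> carrier End_ring"
  then show "\<exists>g\<in>carrier End_ring. g \<oplus>\<^bsub>End_ring\<^esub> h = \<zero>\<^bsub>End_ring\<^esub>"
    by (intro bexI[of _ "\<lambda>x. - h x"]) (auto simp: additive_def)
qed (auto simp: additive_def algebra_simps)

text \<open>The operator k id + m N, where N sends e to f and f to 0.\<close>

definition R_elem :: "int \<Rightarrow> int \<Rightarrow> int \<times> int \<Rightarrow> int \<times> int"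
  where "R_elem k m = (\<lambda>x. (k * fst x, k * snd x + m * fst x))"

lemma R_elem_closed [simp]: "additive (R_elem k m)"
  by (simp add: R_elem_def additive_def algebra_simps)

lemma R_elem_eq_iff [simp]: "R_elem k m = R_elem k' m' \<longleftrightarrow> k = k' \<and> m = m'"
  by (auto simp: R_elem_def dest!: fun_cong[of _ _ "(1, 0)"])

text \<open>The value at e determines the operator; the explicit section and cocycle below read k
  and m off in this way.\<close>

lemma R_elem_coeffs [simp]: "fst (R_elem k m (1, 0)) = k" "snd (R_elem k m (1, 0)) = m"
  by (simp_all add: R_elem_def)

lemma R_elem_in_range [simp]: "R_elem k m \<in> range (case_prod R_elem)"
  by (rule range_eqI[of _ _ "(k, m)"]) simp

lemma R_elem_add: "(\<lambda>x. R_elem k m x + R_elem k' m' x) = R_elem (k + k') (m + m')"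
  by (simp add: R_elem_def algebra_simps)

lemma R_elem_mult: "R_elem k m \<circ> R_elem k' m' = R_elem (k * k') (k * m' + m * k')"
  by (auto simp: R_elem_def algebra_simps)

lemma R_elem_one: "id = R_elem 1 0"
  by (auto simp: R_elem_def)

lemma R_elem_zero: "(\<lambda>_. 0) = R_elem 0 0"
  by (auto simp: R_elem_def zero_prod_def)

lemma R_elem_add_pow: "add_pow End_ring n id = R_elem n 0"
proof -
  interpret abelian_group "End_ring :: (int \<times> int \<Rightarrow> int \<times> int) ring"
    by (rule abelian_group_End_ring)
  show ?thesis
    using additive_int_map[of "\<lambda>n. R_elem n 0" n] by (simp add: R_elem_add R_elem_one)
qed

text \<open>Existence uses the injectivity of \<open>O_elem\<close>, which makes the coordinate map
  \<open>co\<close> available. Uniqueness holds because every element of O is itself the class of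
  one tensor, where the value is prescribed; \<open>extensional\<close> fixes the values off the
  carrier.\<close>

lemma reg_rep_O_elem: "reg_rep ex_tp (O_elem m n) = R_elem 0 m"
proof -
  define P where "P \<rho> \<longleftrightarrow> \<rho> \<in> hom (add_monoid ex_O) (add_monoid End_ring) \<and>
     \<rho> \<in> extensional (carrier ex_O) \<and>
     (\<forall>a \<alpha> b \<beta> x. \<rho> (op_class ex_tp a \<alpha> b \<beta>) x = ex_tp a \<alpha> b \<beta> x)" for \<rho>
  define co where "co = inv_into UNIV (case_prod O_elem)"
  have co: "co (O_elem i j) = (i, j)" for i j
    using inv_into_f_f[of "case_prod O_elem" UNIV "(i, j)"] by (auto simp: co_def inj_on_def)
  define \<rho>\<^sub>0 where "\<rho>\<^sub>0 = restrict (\<lambda>u. R_elem 0 (fst (co u))) (carrier ex_O)"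
  have \<rho>\<^sub>0: "\<rho>\<^sub>0 (O_elem i j) = R_elem 0 i" for i j
    by (simp add: \<rho>\<^sub>0_def co)
  have "\<rho>\<^sub>0 \<in> hom (add_monoid ex_O) (add_monoid End_ring)"
  proof (rule homI)
    fix u v assume "u \<in> carrier (add_monoid ex_O)" "v \<in> carrier (add_monoid ex_O)"
    then obtain i j i' j' where uv: "u = O_elem i j" "v = O_elem i' j'"
      by (auto elim!: O_elem_cases)
    show "\<rho>\<^sub>0 (u \<otimes>\<^bsub>add_monoid ex_O\<^esub> v) = \<rho>\<^sub>0 u \<otimes>\<^bsub>add_monoid End_ring\<^esub> \<rho>\<^sub>0 v"
      by (simp add: uv \<rho>\<^sub>0 O_elem_add R_elem_add)
  qed (auto elim!: O_elem_cases simp: \<rho>\<^sub>0)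
  moreover have "\<rho>\<^sub>0 (op_class ex_tp a \<alpha> b \<beta>) x = ex_tp a \<alpha> b \<beta> x" for a \<alpha> b \<beta> x
    by (simp add: ex_class_O_elem \<rho>\<^sub>0 ex_tp_eq R_elem_def)
  ultimately have P\<rho>\<^sub>0: "P \<rho>\<^sub>0" by (simp add: P_def \<rho>\<^sub>0_def)
  moreover have "\<rho> = \<rho>\<^sub>0" if "P \<rho>" for \<rho>
  proof (rule extensionalityI[of _ "carrier ex_O"])
    fix u assume "u \<in> carrier ex_O"
    then obtain i j where "u = O_elem i j" by (rule O_elem_cases)
    then have "u = ex_class (i, j) 1 e_T 1"
      by (simp add: ex_class_O_elem e_T_def)
    moreover have "\<rho> (ex_class a \<alpha> b \<beta>) = \<rho>\<^sub>0 (ex_class a \<alpha> b \<beta>)" for a \<alpha> b \<beta>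
      using that P\<rho>\<^sub>0 unfolding P_def by (intro ext) metis
    ultimately show "\<rho> u = \<rho>\<^sub>0 u" by simp
  qed (use that P\<rho>\<^sub>0 in \<open>auto simp: P_def\<close>)
  ultimately have "(THE \<rho>. P \<rho>) = \<rho>\<^sub>0"
    by (rule the_equality)
  then have "reg_rep ex_tp = \<rho>\<^sub>0"
    unfolding reg_rep_def P_def .
  then show ?thesis by (simp add: \<rho>\<^sub>0)
qed

section \<open>The ring A(T,Z) in coordinates, the image R_T and the two kernels\<close>

abbreviation ex_A :: "(int \<times> (int \<times> int, int) op_elem) ring"
  where "ex_A \<equiv> A_ring ex_tp"

definition A_elem :: "int \<Rightarrow> int \<Rightarrow> int \<Rightarrow> int \<times> (int \<times> int, int) op_elem"
  where "A_elem k m n = (k, O_elem m n)"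

lemma A_elem_eq_iff [simp]: "A_elem k m n = A_elem k' m' n' \<longleftrightarrow> k = k' \<and> m = m' \<and> n = n'"
  by (auto simp: A_elem_def)

lemma A_elem_closed [simp]: "A_elem k m n \<in> carrier ex_A"
  by (simp add: A_elem_def A_ring_def)

lemma A_elem_cases:
  assumes "a \<in> carrier ex_A"
  obtains k m n where "a = A_elem k m n"
  using assms by (auto simp: A_ring_def A_elem_def elim: O_elem_cases)

lemma A_elem_add: "A_elem k m n \<oplus>\<^bsub>ex_A\<^esub> A_elem k' m' n' = A_elem (k + k') (m + m') (n + n')"
  by (simp add: A_ring_def A_elem_def O_elem_add)

lemma A_elem_mult:
  "A_elem k m n \<otimes>\<^bsub>ex_A\<^esub> A_elem k' m' n' = A_elem (k * k') (k * m' + m * k') (k * n' + m * m' + n * k')"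
  by (simp add: A_ring_def A_elem_def O_elem_add O_elem_mult O_elem_add_pow algebra_simps)

lemma A_elem_one: "\<one>\<^bsub>ex_A\<^esub> = A_elem 1 0 0"
  and A_elem_zero: "\<zero>\<^bsub>ex_A\<^esub> = A_elem 0 0 0"
  by (simp_all add: A_ring_def A_elem_def zero_O_elem)

lemma O_emb_O_elem: "O_emb (O_elem m n) = A_elem 0 m n"
  by (simp add: O_emb_def A_elem_def)

lemma reg_rep_hat_A_elem: "reg_rep_hat ex_tp (A_elem k m n) = R_elem k m"
  by (simp add: reg_rep_hat_def A_elem_def R_elem_add_pow reg_rep_O_elem R_elem_add)

lemma reg_rep_hat_image: "reg_rep_hat ex_tp ` carrier ex_A = range (case_prod R_elem)"
proof
  show "range (case_prod R_elem) \<subseteq> reg_rep_hat ex_tp ` carrier ex_A"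
    by (auto simp: reg_rep_hat_A_elem intro!: image_eqI[of _ _ "A_elem _ _ 0"])
  show "reg_rep_hat ex_tp ` carrier ex_A \<subseteq> range (case_prod R_elem)"
  proof (rule image_subsetI)
    fix a assume "a \<in> carrier ex_A"
    then obtain k m n where "a = A_elem k m n" by (rule A_elem_cases)
    then show "reg_rep_hat ex_tp a \<in> range (case_prod R_elem)"
      by (auto simp: reg_rep_hat_A_elem)
  qed
qed

abbreviation ex_R :: "(int \<times> int \<Rightarrow> int \<times> int) ring"
  where "ex_R \<equiv> R_im ex_tp"

lemma ex_R_simps [simp]:
  "carrier ex_R = range (case_prod R_elem)"
  "g \<oplus>\<^bsub>ex_R\<^esub> h = (\<lambda>x. g x + h x)"
  "g \<otimes>\<^bsub>ex_R\<^esub> h = g \<circ> h"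
  "\<zero>\<^bsub>ex_R\<^esub> = (\<lambda>_. 0)"
  "\<one>\<^bsub>ex_R\<^esub> = id"
  by (simp_all add: R_im_def reg_rep_hat_image)

lemma D_ker_ex: "D_ker ex_tp = range (O_elem 0)"
  by (auto simp: D_ker_def a_kernel_def' reg_rep_O_elem R_elem_zero elim!: O_elem_cases)

text \<open>The operators id and N are linearly independent over Z, so a kernel element has k = m =
  0; hence passing from O to A does not enlarge the kernel.\<close>

lemma K_ker_ex: "K_ker ex_tp = range (A_elem 0 0)"
  by (auto simp: K_ker_def a_kernel_def' reg_rep_hat_A_elem R_elem_zero elim!: A_elem_cases)

section \<open>Truncated polynomial rings\<close>

lemma ZX_cring: "cring ZX"
  unfolding ZX_def using UP_cring.UP_cring[of \<Z>] int_is_cring by (simp add: UP_cring_def)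

lemma carrier_ZX: "f \<in> carrier ZX \<longleftrightarrow> (\<exists>n. \<forall>i>n. f i = 0)"
  by (auto simp: ZX_def UP_def up_def bound_def)

lemma ZX_add: "\<lbrakk>f \<in> carrier ZX; g \<in> carrier ZX\<rbrakk> \<Longrightarrow> f \<oplus>\<^bsub>ZX\<^esub> g = (\<lambda>i. f i + g i)"
  by (simp add: ZX_def UP_def)

lemma ZX_mult: "\<lbrakk>f \<in> carrier ZX; g \<in> carrier ZX\<rbrakk> \<Longrightarrow> f \<otimes>\<^bsub>ZX\<^esub> g = (\<lambda>n. \<Sum>i\<le>n. f i * g (n - i))"
  by (simp add: ZX_def UP_def int_finsum_eq)

lemma ZX_zero: "\<zero>\<^bsub>ZX\<^esub> = (\<lambda>_. 0)" and ZX_one: "\<one>\<^bsub>ZX\<^esub> = (\<lambda>i. if i = 0 then 1 else 0)"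
  by (auto simp: ZX_def UP_def)

lemma X_pow_eq: "X_pow n = (\<lambda>i. if i = n then 1 else 0)"
  by (auto simp: X_pow_def ZX_def UP_def)

lemma X_pow_closed [simp]: "X_pow n \<in> carrier ZX"
  by (auto simp: carrier_ZX X_pow_eq intro!: exI[of _ n])

lemma ZX_mult_X_pow:
  assumes "g \<in> carrier ZX"
  shows "g \<otimes>\<^bsub>ZX\<^esub> X_pow n = (\<lambda>i. if n \<le> i then g (i - n) else 0)"
proof
  fix i
  \<comment> \<open>Only j = i - n contributes. The guard n \<le> i is required because subtraction
    on naturals would otherwise select j = 0.\<close>
  have "(\<Sum>j\<le>i. g j * X_pow n (i - j)) = (\<Sum>j\<le>i. if j = i - n \<and> n \<le> i then g j else 0)"
    by (rule sum.cong) (auto simp: X_pow_eq)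
  then show "(g \<otimes>\<^bsub>ZX\<^esub> X_pow n) i = (if n \<le> i then g (i - n) else 0)"
    using assms by (simp add: ZX_mult)
qed

lemma X_ideal_eq: "X_ideal n = {f \<in> carrier ZX. \<forall>i<n. f i = 0}"
proof -
  interpret cring ZX by (rule ZX_cring)
  have "X_ideal n = {g \<otimes>\<^bsub>ZX\<^esub> X_pow n | g. g \<in> carrier ZX}"
    by (simp add: X_ideal_def cgenideal_eq_genideal[symmetric] cgenideal_def)
  also have "\<dots> = {f \<in> carrier ZX. \<forall>i<n. f i = 0}"
  proof safe
    fix f assume f: "f \<in> carrier ZX" "\<forall>i<n. f i = 0"
    obtain N where N: "\<forall>i>N. f i = 0" using f by (auto simp: carrier_ZX)
    \<comment> \<open>Division by X^n shifts coefficients down; the bound \<open>N\<close> for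
      \<open>f\<close> still works for the quotient.\<close>
    have "(\<lambda>i. f (i + n)) \<in> carrier ZX"
      using N by (auto simp: carrier_ZX intro!: exI[of _ N])
    moreover from this have "f = (\<lambda>i. f (i + n)) \<otimes>\<^bsub>ZX\<^esub> X_pow n"
      using f by (auto simp: ZX_mult_X_pow)
    ultimately show "\<exists>g. f = g \<otimes>\<^bsub>ZX\<^esub> X_pow n \<and> g \<in> carrier ZX" by blast
  next
    fix g assume g: "g \<in> carrier ZX"
    show "g \<otimes>\<^bsub>ZX\<^esub> X_pow n \<in> carrier ZX" using g by simp
    show "(g \<otimes>\<^bsub>ZX\<^esub> X_pow n) i = 0" if "i < n" for i
      using g that by (simp add: ZX_mult_X_pow)
  qed
  finally show ?thesis .
qed

text \<open>The image of a ring under a map respecting its operations is a ring, so \<open>S\<close>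
  inherits the axioms; \<open>h_zero\<close> matches its declared zero with the inherited one. The
  second claim is the first isomorphism theorem, also recording the image of X.\<close>

lemma truncation_ring_iso:
  assumes hom: "h \<in> ring_hom ZX S" and img: "h ` carrier ZX = carrier S"
    and h_zero: "h \<zero>\<^bsub>ZX\<^esub> = \<zero>\<^bsub>S\<^esub>"
    and ker: "\<And>f. f \<in> carrier ZX \<Longrightarrow> h f = \<zero>\<^bsub>S\<^esub> \<longleftrightarrow> (\<forall>i<n. f i = 0)"
  shows "ring (S :: 'a ring)"
    and "\<exists>\<phi> \<in> ring_iso (ZX Quot X_ideal n) S. \<phi> (X_ideal n +>\<^bsub>ZX\<^esub> X_pow 1) = h (X_pow 1)"
proof -
  interpret cring ZX by (rule ZX_cring)
  have "ring (S\<lparr>carrier := h ` carrier ZX, zero := h \<zero>\<^bsub>ZX\<^esub>\<rparr>)"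
    by (rule ring_hom_imp_img_ring[OF hom])
  also have "S\<lparr>carrier := h ` carrier ZX, zero := h \<zero>\<^bsub>ZX\<^esub>\<rparr> = S"
    unfolding img h_zero by simp
  finally show S: "ring S" .
  have h: "ring_hom_ring ZX S h"
    by (rule ring_hom_ringI2[OF ring_axioms S hom])
  have ideal: "a_kernel ZX S h = X_ideal n"
    unfolding a_kernel_def' X_ideal_eq using ker by (intro Collect_cong conj_cong) simp_all
  have "(\<lambda>Y. the_elem (h ` Y)) \<in> ring_iso (ZX Quot X_ideal n) S"
    using ring_hom_ring.FactRing_iso_set[OF h img] by (simp add: ideal)
  moreover have "the_elem (h ` (X_ideal n +>\<^bsub>ZX\<^esub> X_pow 1)) = h (X_pow 1)"
    using ring_hom_ring.the_elem_simp[OF h X_pow_closed] by (simp add: ideal)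
  ultimately show "\<exists>\<phi> \<in> ring_iso (ZX Quot X_ideal n) S. \<phi> (X_ideal n +>\<^bsub>ZX\<^esub> X_pow 1) = h (X_pow 1)"
    by (intro bexI[of _ "\<lambda>Y. the_elem (h ` Y)"])
qed

text \<open>The polynomial k + m X + n X^2 realises any three prescribed low coefficients.\<close>

lemma ZX_image:
  assumes "\<And>f. g f = g' (f 0) (f 1) (f 2)"
  shows "g ` carrier ZX = {g' k m n | k m n. True}"
proof (intro equalityI subsetI)
  fix y assume "y \<in> {g' k m n | k m n. True}"
  then obtain k m n where y: "y = g' k m n" by blast
  define f :: "nat \<Rightarrow> int" where "f = (\<lambda>i. if i = 0 then k else if i = 1 then m else if i = 2 then n else 0)"
  have "f \<in> carrier ZX" by (auto simp: carrier_ZX f_def intro!: exI[of _ 2])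
  moreover have "y = g f" by (simp add: y assms f_def)
  ultimately show "y \<in> g ` carrier ZX" by blast
qed (auto simp: assms)

lemma ex_A_ring: "ring ex_A"
  and ex_A_iso: "\<exists>\<phi> \<in> ring_iso (ZX Quot X_ideal 3) ex_A. \<phi> (X_ideal 3 +>\<^bsub>ZX\<^esub> X_pow 1) = A_elem 0 1 0"
proof -
  let ?h = "\<lambda>f. A_elem (f 0) (f 1) (f 2)"
  have hom: "?h \<in> ring_hom ZX ex_A"
    by (rule ring_hom_memI)
      (auto simp: ZX_add ZX_mult ZX_one A_elem_add A_elem_mult A_elem_one numeral_2_eq_2)
  have img: "?h ` carrier ZX = carrier ex_A"
    by (subst ZX_image[of _ A_elem]) (auto elim!: A_elem_cases)
  have zero: "?h \<zero>\<^bsub>ZX\<^esub> = \<zero>\<^bsub>ex_A\<^esub>"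
    by (simp add: ZX_zero A_elem_zero)
  have ker: "?h f = \<zero>\<^bsub>ex_A\<^esub> \<longleftrightarrow> (\<forall>i<3. f i = 0)" for f :: "nat \<Rightarrow> int"
    by (auto simp: A_elem_zero numeral_3_eq_3 numeral_2_eq_2 less_Suc_eq)
  show "ring ex_A" by (rule truncation_ring_iso(1)[OF hom img zero ker])
  show "\<exists>\<phi> \<in> ring_iso (ZX Quot X_ideal 3) ex_A. \<phi> (X_ideal 3 +>\<^bsub>ZX\<^esub> X_pow 1) = A_elem 0 1 0"
    using truncation_ring_iso(2)[OF hom img zero ker] by (simp add: X_pow_eq)
qed

lemma ex_R_iso: "\<exists>\<psi> \<in> ring_iso (ZX Quot X_ideal 2) ex_R. \<psi> (X_ideal 2 +>\<^bsub>ZX\<^esub> X_pow 1) = R_elem 0 1"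
proof -
  let ?h = "\<lambda>f. R_elem (f 0) (f 1)"
  have hom: "?h \<in> ring_hom ZX ex_R"
    by (rule ring_hom_memI)
      (auto simp: ZX_add ZX_mult ZX_one R_elem_add R_elem_mult R_elem_one)
  have img: "?h ` carrier ZX = carrier ex_R"
    by (subst ZX_image[of _ "\<lambda>k m n. R_elem k m"]) auto
  have zero: "?h \<zero>\<^bsub>ZX\<^esub> = \<zero>\<^bsub>ex_R\<^esub>"
    by (simp add: ZX_zero R_elem_zero)
  have ker: "?h f = \<zero>\<^bsub>ex_R\<^esub> \<longleftrightarrow> (\<forall>i<2. f i = 0)" for f :: "nat \<Rightarrow> int"
    by (auto simp: R_elem_zero numeral_2_eq_2 less_Suc_eq)
  show "\<exists>\<psi> \<in> ring_iso (ZX Quot X_ideal 2) ex_R. \<psi> (X_ideal 2 +>\<^bsub>ZX\<^esub> X_pow 1) = R_elem 0 1"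
    using truncation_ring_iso(2)[OF hom img zero ker] by (simp add: X_pow_eq)
qed

section \<open>The kernel and its coinvariants\<close>

interpretation ex_A: ring ex_A
  by (rule ex_A_ring)

lemma ex_A_cring: "cring ex_A"
proof -
  have "a \<otimes>\<^bsub>ex_A\<^esub> b = b \<otimes>\<^bsub>ex_A\<^esub> a" if "a \<in> carrier ex_A" "b \<in> carrier ex_A" for a b
    using that by (elim A_elem_cases) (simp add: A_elem_mult algebra_simps)
  then show ?thesis
    by (intro cring.intro ex_A_ring ex_A.monoid_comm_monoidI)
qed

lemma A_elem_add_pow: "add_pow ex_A (j::int) (A_elem k m n) = A_elem (j * k) (j * m) (j * n)"
  using ex_A.additive_int_map[of "\<lambda>j. A_elem (j * k) (j * m) (j * n)" j]
  by (simp add: A_elem_add algebra_simps)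

lemma A_elem_minus: "A_elem k m n \<ominus>\<^bsub>ex_A\<^esub> A_elem k' m' n' = A_elem (k - k') (m - m') (n - n')"
proof -
  have "\<ominus>\<^bsub>ex_A\<^esub> A_elem k' m' n' = A_elem (- k') (- m') (- n')"
    by (rule ex_A.minus_equality) (simp_all add: A_elem_add A_elem_zero)
  then show ?thesis
    by (simp add: ex_A.minus_eq A_elem_add)
qed

lemma D_ker_iso:
  "(\<lambda>n. add_pow ex_O n q_ex) \<in> iso integer_group ((add_monoid ex_O)\<lparr>carrier := D_ker ex_tp\<rparr>)"
proof -
  have "(\<lambda>n. add_pow ex_O n q_ex) = O_elem 0"
    by (simp add: fun_eq_iff q_ex_O_elem O_elem_add_pow)
  then show ?thesis
    by (auto simp: iso_def hom_def bij_betw_def inj_on_def D_ker_ex O_elem_add)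
qed

lemma K_group_simps [simp]:
  "carrier (K_group ex_tp) = range (A_elem 0 0)"
  "x \<otimes>\<^bsub>K_group ex_tp\<^esub> y = x \<oplus>\<^bsub>ex_A\<^esub> y"
  "\<one>\<^bsub>K_group ex_tp\<^esub> = \<zero>\<^bsub>ex_A\<^esub>"
  by (simp_all add: K_group_def K_ker_ex)

lemma K_iso: "A_elem 0 0 \<in> iso integer_group (K_group ex_tp)"
  by (auto simp: iso_def hom_def bij_betw_def inj_on_def A_elem_add)

lemma K_group_group: "group (K_group ex_tp)"
proof (rule groupI)
  fix x assume "x \<in> carrier (K_group ex_tp)"
  then obtain n where "x = A_elem 0 0 n" by auto
  then show "\<exists>y\<in>carrier (K_group ex_tp). y \<otimes>\<^bsub>K_group ex_tp\<^esub> x = \<one>\<^bsub>K_group ex_tp\<^esub>"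
    by (intro bexI[of _ "A_elem 0 0 (- n)"]) (auto simp: A_elem_add A_elem_zero)
qed (auto simp: A_elem_add A_elem_zero)

lemma K_group_pow: "A_elem 0 0 1 [^]\<^bsub>K_group ex_tp\<^esub> (n::int) = A_elem 0 0 n"
  using hom_int_pow[of "A_elem 0 0" integer_group "K_group ex_tp" 1 n] K_iso K_group_group
  by (simp add: iso_def)

lemma K_sq_ex: "K_sq ex_tp = {\<zero>\<^bsub>ex_A\<^esub>}"
  unfolding K_sq_def K_ker_ex
proof (rule subset_antisym)
  show "ideal_prod ex_A (range (A_elem 0 0)) (range (A_elem 0 0)) \<subseteq> {\<zero>\<^bsub>ex_A\<^esub>}"
  proof
    fix x assume "x \<in> ideal_prod ex_A (range (A_elem 0 0)) (range (A_elem 0 0))"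
    then show "x \<in> {\<zero>\<^bsub>ex_A\<^esub>}"
      by (induction rule: ideal_prod.induct) (auto simp: A_elem_mult A_elem_add A_elem_zero)
  qed
  \<comment> \<open>\<open>ideal_prod\<close> is generated by products and sums, so zero has to
    enter it as a product.\<close>
  have "A_elem 0 0 0 \<otimes>\<^bsub>ex_A\<^esub> A_elem 0 0 0
      \<in> ideal_prod ex_A (range (A_elem 0 0)) (range (A_elem 0 0))"
    by (intro ideal_prod.prod rangeI)
  then show "{\<zero>\<^bsub>ex_A\<^esub>} \<subseteq> ideal_prod ex_A (range (A_elem 0 0)) (range (A_elem 0 0))"
    by (simp add: A_elem_mult A_elem_zero)
qed

text \<open>Since K^2 = 0, cosets are singletons, and the n-th power of the class of q is the
  singleton of n q.\<close>

lemma C_group_iso: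
  "(\<lambda>n::int. (K_sq ex_tp #>\<^bsub>K_group ex_tp\<^esub> O_emb q_ex) [^]\<^bsub>C_group ex_tp\<^esub> n)
     \<in> iso integer_group (C_group ex_tp)"
proof -
  interpret K: group "K_group ex_tp" by (rule K_group_group)
  interpret normal "K_sq ex_tp" "K_group ex_tp"
    using K.one_is_normal by (simp add: K_sq_ex)
  have coset: "K_sq ex_tp #>\<^bsub>K_group ex_tp\<^esub> A_elem 0 0 n = {A_elem 0 0 n}" for n
    by (simp add: K_sq_ex r_coset_def A_elem_zero A_elem_add)
  have "(K_sq ex_tp #>\<^bsub>K_group ex_tp\<^esub> O_emb q_ex) [^]\<^bsub>C_group ex_tp\<^esub> n = {A_elem 0 0 n}" for n :: int
    using FactGroup_int_pow[of "A_elem 0 0 1" n]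
    by (simp add: C_group_def q_ex_O_elem O_emb_O_elem coset K_group_pow)
  moreover have "carrier (C_group ex_tp) = range (\<lambda>n. {A_elem 0 0 n})"
    by (simp add: C_group_def carrier_FactGroup image_image coset)
  ultimately show ?thesis
    by (auto simp: iso_def hom_def bij_betw_def inj_on_def C_group_def set_mult_def A_elem_add)
qed

text \<open>Both p and q annihilate p^2 = q, so an element with constant term k multiplies q to k q;
  the multiples of q are therefore exactly its integer multiples.\<close>

lemma K_ker_Idl: "K_ker ex_tp = Idl\<^bsub>ex_A\<^esub> {O_emb p_ex [^]\<^bsub>ex_A\<^esub> (2::nat)}"
proof -
  interpret cring ex_A by (rule ex_A_cring)
  have p2: "O_emb p_ex [^]\<^bsub>ex_A\<^esub> (2::nat) = A_elem 0 0 1"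
    by (simp add: numeral_2_eq_2 p_ex_O_elem O_emb_O_elem A_elem_mult A_elem_one)
  have "PIdl\<^bsub>ex_A\<^esub> (A_elem 0 0 1) = range (A_elem 0 0)"
  proof
    show "range (A_elem 0 0) \<subseteq> PIdl\<^bsub>ex_A\<^esub> (A_elem 0 0 1)"
    proof (rule image_subsetI)
      fix n
      have "A_elem 0 0 n = A_elem n 0 0 \<otimes>\<^bsub>ex_A\<^esub> A_elem 0 0 1" by (simp add: A_elem_mult)
      then show "A_elem 0 0 n \<in> PIdl\<^bsub>ex_A\<^esub> (A_elem 0 0 1)"
        unfolding cgenideal_def using A_elem_closed by blast
    qed
    show "PIdl\<^bsub>ex_A\<^esub> (A_elem 0 0 1) \<subseteq> range (A_elem 0 0)"
    proof
      fix x assume "x \<in> PIdl\<^bsub>ex_A\<^esub> (A_elem 0 0 1)"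
      then obtain a where "a \<in> carrier ex_A" "x = a \<otimes>\<^bsub>ex_A\<^esub> A_elem 0 0 1"
        by (auto simp: cgenideal_def)
      then show "x \<in> range (A_elem 0 0)"
        by (elim A_elem_cases) (simp add: A_elem_mult)
    qed
  qed
  then show ?thesis
    using cgenideal_eq_genideal[of "A_elem 0 0 1"] by (simp add: p2 K_ker_ex)
qed

section \<open>The regular extension class of the example\<close>

abbreviation ex_K :: "(int \<times> int \<Rightarrow> int \<times> int, int \<times> (int \<times> int, int) op_elem) bimodule"
  where "ex_K \<equiv> K_bimodule ex_tp"

lemma ex_K_simps [simp]:
  "carrier ex_K = range (A_elem 0 0)"
  "x \<oplus>\<^bsub>ex_K\<^esub> y = x \<oplus>\<^bsub>ex_A\<^esub> y"
  "\<zero>\<^bsub>ex_K\<^esub> = \<zero>\<^bsub>ex_A\<^esub>"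
  by (simp_all add: K_bimodule_def K_ker_ex)

interpretation ex_K: abelian_group ex_K
proof (rule abelian_groupI)
  fix x assume "x \<in> carrier ex_K"
  then obtain n where "x = A_elem 0 0 n" by auto
  then show "\<exists>y\<in>carrier ex_K. y \<oplus>\<^bsub>ex_K\<^esub> x = \<zero>\<^bsub>ex_K\<^esub>"
    by (intro bexI[of _ "A_elem 0 0 (- n)"]) (auto simp: A_elem_add A_elem_zero)
qed (auto simp: A_elem_add A_elem_zero algebra_simps)

lemma ex_K_add_pow: "add_pow ex_K (j::int) (A_elem 0 0 n) = A_elem 0 0 (j * n)"
  using ex_K.additive_int_map[of "\<lambda>j. A_elem 0 0 (j * n)" j]
  by (simp add: A_elem_add algebra_simps)

text \<open>These are the inner sums of \<open>hh_diff\<close> in degrees 1 and 2. The summands are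
  passed in normal form so that the result is a single \<open>A_elem\<close>.\<close>

lemma ex_K_finsum:
  fixes f :: "nat \<Rightarrow> int \<times> (int \<times> int, int) op_elem"
  shows "f 0 = A_elem 0 0 u \<Longrightarrow> finsum ex_K f {..<1} = A_elem 0 0 u"
    and "\<lbrakk>f 0 = A_elem 0 0 u; f 1 = A_elem 0 0 v\<rbrakk> \<Longrightarrow> finsum ex_K f {..<2} = A_elem 0 0 (u + v)"
proof -
  have "{..<1} = {0::nat}" "{..<2} = {0, 1::nat}" by auto
  then show "f 0 = A_elem 0 0 u \<Longrightarrow> finsum ex_K f {..<1} = A_elem 0 0 u"
    and "\<lbrakk>f 0 = A_elem 0 0 u; f 1 = A_elem 0 0 v\<rbrakk> \<Longrightarrow> finsum ex_K f {..<2} = A_elem 0 0 (u + v)"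
    by (simp_all add: A_elem_add)
qed

text \<open>Lifts of \<open>R_elem k m\<close> differ by multiples of q, which kill K, and p kills K
  as well. Hence only k acts.\<close>

lemma ex_K_act:
  "lact ex_K (R_elem k m) (A_elem 0 0 n) = A_elem 0 0 (k * n)"
  "ract ex_K (A_elem 0 0 n) (R_elem k m) = A_elem 0 0 (n * k)"
proof -
  have *: "a \<otimes>\<^bsub>ex_A\<^esub> A_elem 0 0 n = A_elem 0 0 (k * n) \<and> A_elem 0 0 n \<otimes>\<^bsub>ex_A\<^esub> a = A_elem 0 0 (n * k)"
    if "a \<in> carrier ex_A" "reg_rep_hat ex_tp a = R_elem k m" for a
    using that by (elim A_elem_cases) (simp add: reg_rep_hat_A_elem A_elem_mult)
  \<comment> \<open>Without a lift the condition in the definite description would be vacuous and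
    every value would satisfy it.\<close>
  have ex: "A_elem k m 0 \<in> carrier ex_A" "reg_rep_hat ex_tp (A_elem k m 0) = R_elem k m"
    by (simp_all add: reg_rep_hat_A_elem)
  show "lact ex_K (R_elem k m) (A_elem 0 0 n) = A_elem 0 0 (k * n)"
    unfolding K_bimodule_def bimodule.simps
    by (rule the_equality) (use * ex in metis)+
  show "ract ex_K (A_elem 0 0 n) (R_elem k m) = A_elem 0 0 (n * k)"
    unfolding K_bimodule_def bimodule.simps
    by (rule the_equality) (use * ex in metis)+
qed

text \<open>Being a section fixes the coordinates k and m of the lift and leaves its q-coordinate
  free. Additivity makes that coordinate linear in k and m, and s(1) = 1 removes k; t is its value
  at \<open>R_elem 0 1\<close>.\<close>

lemma unital_additive_section_form:
  assumes "unital_additive_section ex_tp s"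
  obtains t where "\<And>k m. s (R_elem k m) = A_elem k m (m * t)"
proof -
  have hom: "s (R_elem k m) \<in> carrier ex_A"
    "s (R_elem (k + k') (m + m')) = s (R_elem k m) \<oplus>\<^bsub>ex_A\<^esub> s (R_elem k' m')"
    "reg_rep_hat ex_tp (s (R_elem k m)) = R_elem k m" "s (R_elem 1 0) = A_elem 1 0 0" for k m k' m'
    using assms
    by (auto simp: unital_additive_section_def hom_def R_elem_one A_elem_one R_elem_add[symmetric])
  obtain k m t where "s (R_elem 0 1) = A_elem k m t"
    using hom(1) by (rule A_elem_cases)
  with hom(3)[of 0 1] have t: "s (R_elem 0 1) = A_elem 0 1 t"
    by (simp add: reg_rep_hat_A_elem)
  have "s (R_elem k m) = A_elem k m (m * t)" for k m
  proof -
    have "s (R_elem j 0) = add_pow ex_A j (s (R_elem 1 0))" for j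
      by (rule ex_A.additive_int_map[of "\<lambda>j. s (R_elem j 0)"]) (use hom(1) hom(2)[of _ _ 0 0] in auto)
    moreover have "s (R_elem 0 j) = add_pow ex_A j (s (R_elem 0 1))" for j
      by (rule ex_A.additive_int_map[of "\<lambda>j. s (R_elem 0 j)"]) (use hom(1) hom(2)[of 0 0] in auto)
    ultimately show ?thesis
      using hom(2)[of k 0 0 m] by (simp add: hom(4) t A_elem_add_pow A_elem_add)
  qed
  then show thesis by (rule that)
qed

text \<open>The section with t = 0, lifting k id + m N to k + m p.\<close>

lemma unital_additive_section_ex:
  "unital_additive_section ex_tp (\<lambda>r. A_elem (fst (r (1, 0))) (snd (r (1, 0))) 0)"
  by (auto simp: unital_additive_section_def hom_def A_elem_add reg_rep_hat_A_elem A_elem_one)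

definition ex_cocycle :: "(int \<times> int \<Rightarrow> int \<times> int) list \<Rightarrow> int \<times> (int \<times> int, int) op_elem"
  where "ex_cocycle = (\<lambda>xs\<in>tuples ex_R 2. A_elem 0 0 (snd ((xs ! 0) (1, 0)) * snd ((xs ! 1) (1, 0))))"

lemma tuples_0: "tuples R 0 = {[]}"
  by (auto simp: tuples_def)

lemma tuples_Suc: "xs \<in> tuples R (Suc n) \<longleftrightarrow> (\<exists>y ys. xs = y # ys \<and> y \<in> carrier R \<and> ys \<in> tuples R n)"
  by (cases xs) (auto simp: tuples_def)

lemma ex_cocycle_R_elem: "ex_cocycle [R_elem k m, R_elem k' m'] = A_elem 0 0 (m * m')"
  by (simp add: ex_cocycle_def numeral_2_eq_2 tuples_Suc tuples_0)

text \<open>The q-coordinate of s(r) s(r') is m m' + (k m' + m k') t, and that of s(r r') is (k m' +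
  m k') t, so t cancels.\<close>

lemma section_cocycle_ex:
  assumes "unital_additive_section ex_tp s"
  shows "section_cocycle ex_tp s = ex_cocycle"
proof -
  obtain t where t: "\<And>k m. s (R_elem k m) = A_elem k m (m * t)"
    using unital_additive_section_form[OF assms] by blast
  show ?thesis
  proof (rule extensionalityI[of _ "tuples ex_R 2"])
    fix xs assume xs: "xs \<in> tuples ex_R 2"
    then obtain k m k' m' where xs_eq: "xs = [R_elem k m, R_elem k' m']"
      by (auto simp: numeral_2_eq_2 tuples_Suc tuples_0)
    show "section_cocycle ex_tp s xs = ex_cocycle xs"
      using xs unfolding xs_eq ex_cocycle_R_elem
      by (simp add: section_cocycle_def t R_elem_mult A_elem_mult A_elem_minus algebra_simps)
  qed (auto simp: section_cocycle_def ex_cocycle_def)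
qed

text \<open>The description is unique because the cocycles of any two sections are equal, not merely
  cohomologous.\<close>

lemma regular_extension_class_ex: "regular_extension_class ex_tp = hh_class ex_R ex_K 2 ex_cocycle"
  unfolding regular_extension_class_def
proof (rule the_equality)
  show "\<exists>s. unital_additive_section ex_tp s \<and>
      hh_class ex_R ex_K 2 ex_cocycle = hh_class ex_R ex_K 2 (section_cocycle ex_tp s)"
    using unital_additive_section_ex section_cocycle_ex[OF unital_additive_section_ex] by auto
qed (auto simp: section_cocycle_ex)

section \<open>Cocycles and coboundaries in degree 2\<close>

lemma ex_cocycle_in_cocycles: "ex_cocycle \<in> carrier (hh_cocycles ex_R ex_K 2)"
proof -
  have "ex_cocycle \<in> carrier (hh_cochains ex_R ex_K 2)"
  proof -
    have "ex_cocycle (xs[i := x \<oplus>\<^bsub>ex_R\<^esub> y]) = ex_cocycle (xs[i := x]) \<oplus>\<^bsub>ex_K\<^esub> ex_cocycle (xs[i := y])"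
      if xs: "xs \<in> tuples ex_R 2" and i: "i < 2" and x: "x \<in> carrier ex_R" and y: "y \<in> carrier ex_R" for xs i x y
    proof -
      obtain k m k' m' where xs_eq: "xs = [R_elem k m, R_elem k' m']"
        using xs by (auto simp: numeral_2_eq_2 tuples_Suc tuples_0)
      obtain a b c d where xy: "x = R_elem a b" "y = R_elem c d" using x y by auto
      have "i = 0 \<or> i = 1" using i by auto
      then show ?thesis
        by (auto simp: xs_eq xy R_elem_add ex_cocycle_R_elem A_elem_add algebra_simps)
    qed
    moreover have "ex_cocycle \<in> tuples ex_R 2 \<rightarrow>\<^sub>E carrier ex_K"
      by (auto simp: ex_cocycle_def)
    ultimately show ?thesis by (simp add: hh_cochains_def del: ex_R_simps ex_K_simps)
  qed
  moreover have "hh_diff ex_R ex_K 2 ex_cocycle = \<one>\<^bsub>hh_cochains ex_R ex_K (Suc 2)\<^esub>"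
  proof (rule extensionalityI[of _ "tuples ex_R (Suc 2)"])
    fix xs assume xs: "xs \<in> tuples ex_R (Suc 2)"
    then obtain k m k' m' k'' m'' where xs_eq: "xs = [R_elem k m, R_elem k' m', R_elem k'' m'']"
      by (auto simp: numeral_2_eq_2 tuples_Suc tuples_0)
    \<comment> \<open>The two inner terms carry the signs - and +. The outer terms k m' m'' and - m
      m' k'' cancel what remains of them.\<close>
    show "hh_diff ex_R ex_K 2 ex_cocycle xs = \<one>\<^bsub>hh_cochains ex_R ex_K (Suc 2)\<^esub> xs"
      using xs unfolding hh_diff_def
      by (subst restrict_apply', assumption,
          subst ex_K_finsum(2)[of _ "- ((k * m' + m * k') * m'')" "m * (k' * m'' + m' * k'')"])
        (simp_all add: hh_cochains_def xs_eq ex_cocycle_R_elem ex_K_act ex_K_add_pow R_elem_mult A_elem_add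
          A_elem_zero algebra_simps)
  qed (auto simp: hh_diff_def hh_cochains_def)
  ultimately show ?thesis by (simp add: hh_cocycles_def)
qed

lemma coboundary_at_square_zero:
  assumes "g \<in> carrier (hh_cochains ex_R ex_K 1)"
  shows "hh_diff ex_R ex_K 1 g [R_elem 0 1, R_elem 0 1] = \<zero>\<^bsub>ex_K\<^esub>"
proof -
  have R: "R_elem k m \<in> carrier ex_R" for k m by simp
  have tup: "[R_elem k m] \<in> tuples ex_R 1" for k m
    by (simp add: tuples_def)
  have "g [R_elem k m] \<in> carrier ex_K" for k m
    using assms tup by (auto simp: hh_cochains_def simp del: ex_K_simps)
  then obtain c where c: "\<And>k m. g [R_elem k m] = A_elem 0 0 (c k m)"
    by (simp add: image_iff) metis
  have "g (xs[0 := x \<oplus>\<^bsub>ex_R\<^esub> y]) = g (xs[0 := x]) \<oplus>\<^bsub>ex_K\<^esub> g (xs[0 := y])"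
    if "xs \<in> tuples ex_R 1" "x \<in> carrier ex_R" "y \<in> carrier ex_R" for xs x y
    using assms that by (simp add: hh_cochains_def del: ex_R_simps ex_K_simps)
  \<comment> \<open>Additivity at 0 + 0 gives g(0) = 0, which settles the middle term of the
    differential.\<close>
  from this[OF tup R R, of 0 0 0 0 0 0] have "c 0 0 = 0"
    by (simp add: R_elem_add c A_elem_add)
  moreover have tup2: "[R_elem 0 1, R_elem 0 1] \<in> tuples ex_R (Suc 1)"
    by (simp add: tuples_def)
  ultimately show ?thesis
    unfolding hh_diff_def
    by (subst restrict_apply'[OF tup2], subst ex_K_finsum(1)[of _ 0])
      (simp_all add: c ex_K_act ex_K_add_pow R_elem_mult A_elem_add A_elem_zero)
qed

text \<open>If the class is trivial, its coset equals the set of coboundaries. A zero coboundary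
  exhibits the cocycle as a member of the coset, and hence as a coboundary.\<close>

lemma zero_in_coboundaries: "\<one>\<^bsub>hh_cochains ex_R ex_K 2\<^esub> \<in> hh_coboundaries ex_R ex_K 2"
proof -
  let ?z = "\<one>\<^bsub>hh_cochains ex_R ex_K 1\<^esub>"
  have z: "?z \<in> carrier (hh_cochains ex_R ex_K 1)"
    by (auto simp: hh_cochains_def tuples_def A_elem_zero A_elem_add set_update_subset_insert R_elem_add
      dest!: subsetD[OF set_update_subset_insert])
  have z_app: "?z [R_elem k m] = A_elem 0 0 0" for k m
    by (simp add: hh_cochains_def tuples_def A_elem_zero)
  have "hh_diff ex_R ex_K 1 ?z = \<one>\<^bsub>hh_cochains ex_R ex_K 2\<^esub>"
  proof (rule extensionalityI[of _ "tuples ex_R 2"])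
    fix xs assume xs: "xs \<in> tuples ex_R 2"
    then obtain k m k' m' where xs_eq: "xs = [R_elem k m, R_elem k' m']"
      by (auto simp: numeral_2_eq_2 tuples_Suc tuples_0)
    have "hh_diff ex_R ex_K 1 ?z xs = A_elem 0 0 0"
      using xs unfolding hh_diff_def numeral_2_eq_2 One_nat_def[symmetric]
      by (subst restrict_apply', assumption, subst ex_K_finsum(1)[of _ 0])
        (simp_all add: xs_eq z_app[simplified] numeral_2_eq_2 ex_K_act ex_K_add_pow R_elem_mult A_elem_add)
    then show "hh_diff ex_R ex_K 1 ?z xs = \<one>\<^bsub>hh_cochains ex_R ex_K 2\<^esub> xs"
      using xs by (simp add: hh_cochains_def A_elem_zero)
  qed (auto simp: hh_diff_def hh_cochains_def numeral_2_eq_2)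
  with z show ?thesis
    by (force simp: numeral_2_eq_2)
qed

lemma regular_extension_class_in_HH: "regular_extension_class ex_tp \<in> carrier (HH ex_R ex_K 2)"
  using ex_cocycle_in_cocycles
  by (auto simp: HH_def carrier_FactGroup regular_extension_class_ex hh_class_def)

lemma regular_extension_class_nonzero: "regular_extension_class ex_tp \<noteq> \<one>\<^bsub>HH ex_R ex_K 2\<^esub>"
proof
  assume "regular_extension_class ex_tp = \<one>\<^bsub>HH ex_R ex_K 2\<^esub>"
  then have eq: "hh_coboundaries ex_R ex_K 2 #>\<^bsub>hh_cocycles ex_R ex_K 2\<^esub> ex_cocycle = hh_coboundaries ex_R ex_K 2"
    by (simp add: regular_extension_class_ex hh_class_def HH_def)
  \<comment> \<open>Elements of the coset are products of a coboundary with the cocycle. The zero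
    cochain yields one with the same values as the cocycle, and only its value at (p, p) is
    used.\<close>
  have "\<one>\<^bsub>hh_cochains ex_R ex_K 2\<^esub> \<otimes>\<^bsub>hh_cocycles ex_R ex_K 2\<^esub> ex_cocycle
      \<in> hh_coboundaries ex_R ex_K 2 #>\<^bsub>hh_cocycles ex_R ex_K 2\<^esub> ex_cocycle"
    using zero_in_coboundaries by (auto simp: r_coset_def)
  then have "\<one>\<^bsub>hh_cochains ex_R ex_K 2\<^esub> \<otimes>\<^bsub>hh_cocycles ex_R ex_K 2\<^esub> ex_cocycle \<in> hh_coboundaries ex_R ex_K 2"
    by (simp only: eq)
  then obtain g where g: "g \<in> carrier (hh_cochains ex_R ex_K 1)"
    "\<one>\<^bsub>hh_cochains ex_R ex_K 2\<^esub> \<otimes>\<^bsub>hh_cocycles ex_R ex_K 2\<^esub> ex_cocycle = hh_diff ex_R ex_K 1 g"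
    by (auto simp: numeral_2_eq_2)
  have "(\<one>\<^bsub>hh_cochains ex_R ex_K 2\<^esub> \<otimes>\<^bsub>hh_cocycles ex_R ex_K 2\<^esub> ex_cocycle) [R_elem 0 1, R_elem 0 1] = A_elem 0 0 1"
    by (simp add: hh_cocycles_def hh_cochains_def tuples_def ex_cocycle_R_elem A_elem_zero A_elem_add)
  with coboundary_at_square_zero[OF g(1)] show False
    by (simp add: g(2) A_elem_zero)
qed

theorem theorem14p2:
  shows "ternary_gamma_ring ex_tp
    \<and> op_class ex_tp e_T 1 f_T 1 = q_ex
    \<and> (\<lambda>(m, n). [m] \<cdot>\<^bsub>O_ring ex_tp\<^esub> p_ex \<oplus>\<^bsub>O_ring ex_tp\<^esub> [n] \<cdot>\<^bsub>O_ring ex_tp\<^esub> q_ex)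
        \<in> iso (integer_group \<times>\<times> integer_group) (add_monoid (O_ring ex_tp))
    \<and> p_ex \<otimes>\<^bsub>O_ring ex_tp\<^esub> p_ex = q_ex
    \<and> p_ex \<otimes>\<^bsub>O_ring ex_tp\<^esub> q_ex = \<zero>\<^bsub>O_ring ex_tp\<^esub>
    \<and> q_ex \<otimes>\<^bsub>O_ring ex_tp\<^esub> p_ex = \<zero>\<^bsub>O_ring ex_tp\<^esub>
    \<and> q_ex \<otimes>\<^bsub>O_ring ex_tp\<^esub> q_ex = \<zero>\<^bsub>O_ring ex_tp\<^esub>
    \<and> reg_rep ex_tp p_ex e_T = f_T
    \<and> reg_rep ex_tp p_ex f_T = 0
    \<and> (\<forall>t. reg_rep ex_tp q_ex t = 0)
    \<and> (\<lambda>n. [n] \<cdot>\<^bsub>O_ring ex_tp\<^esub> q_ex)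
        \<in> iso integer_group ((add_monoid (O_ring ex_tp))\<lparr>carrier := D_ker ex_tp\<rparr>)
    \<and> K_ker ex_tp = O_emb ` D_ker ex_tp
    \<and> (\<lambda>n. [n] \<cdot>\<^bsub>A_ring ex_tp\<^esub> O_emb q_ex) \<in> iso integer_group (K_group ex_tp)
    \<and> (\<lambda>n::int. (K_sq ex_tp #>\<^bsub>K_group ex_tp\<^esub> O_emb q_ex) [^]\<^bsub>C_group ex_tp\<^esub> n)
        \<in> iso integer_group (C_group ex_tp)
    \<and> (\<exists>\<phi> \<in> ring_iso (ZX Quot X_ideal 3) (A_ring ex_tp).
          \<phi> (X_ideal 3 +>\<^bsub>ZX\<^esub> X_pow 1) = O_emb p_ex)
    \<and> (\<exists>\<psi> \<in> ring_iso (ZX Quot X_ideal 2) (R_im ex_tp).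
          \<psi> (X_ideal 2 +>\<^bsub>ZX\<^esub> X_pow 1) = reg_rep_hat ex_tp (O_emb p_ex))
    \<and> K_ker ex_tp = Idl\<^bsub>A_ring ex_tp\<^esub> {O_emb p_ex [^]\<^bsub>A_ring ex_tp\<^esub> (2::nat)}
    \<and> K_sq ex_tp = {\<zero>\<^bsub>A_ring ex_tp\<^esub>}
    \<and> (\<exists>s. unital_additive_section ex_tp s)
    \<and> (\<forall>s. unital_additive_section ex_tp s \<longrightarrow>
          regular_extension_class ex_tp
            = hh_class (R_im ex_tp) (K_bimodule ex_tp) 2 (section_cocycle ex_tp s))
    \<and> regular_extension_class ex_tp \<in> carrier (HH (R_im ex_tp) (K_bimodule ex_tp) 2)
    \<and> regular_extension_class ex_tp \<noteq> \<one>\<^bsub>HH (R_im ex_tp) (K_bimodule ex_tp) 2\<^esub>"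
proof (intro conjI)
  show "ternary_gamma_ring ex_tp" by (rule ternary_gamma_ring_ex)
  show "op_class ex_tp e_T 1 f_T 1 = q_ex" by (rule ex_class_e_f)
  show "(\<lambda>(m, n). [m] \<cdot>\<^bsub>ex_O\<^esub> p_ex \<oplus>\<^bsub>ex_O\<^esub> [n] \<cdot>\<^bsub>ex_O\<^esub> q_ex)
        \<in> iso (integer_group \<times>\<times> integer_group) (add_monoid ex_O)"
    using O_elem_iso unfolding O_elem_def .
  show "p_ex \<otimes>\<^bsub>ex_O\<^esub> p_ex = q_ex" "p_ex \<otimes>\<^bsub>ex_O\<^esub> q_ex = \<zero>\<^bsub>ex_O\<^esub>"
    "q_ex \<otimes>\<^bsub>ex_O\<^esub> p_ex = \<zero>\<^bsub>ex_O\<^esub>" "q_ex \<otimes>\<^bsub>ex_O\<^esub> q_ex = \<zero>\<^bsub>ex_O\<^esub>"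
    unfolding p_ex_O_elem q_ex_O_elem zero_O_elem by (simp_all add: O_elem_mult)
  show "reg_rep ex_tp p_ex e_T = f_T" "reg_rep ex_tp p_ex f_T = 0" "\<forall>t. reg_rep ex_tp q_ex t = 0"
    unfolding p_ex_O_elem q_ex_O_elem
    by (simp_all add: reg_rep_O_elem R_elem_def e_T_def f_T_def zero_prod_def)
  show "(\<lambda>n. [n] \<cdot>\<^bsub>ex_O\<^esub> q_ex) \<in> iso integer_group ((add_monoid ex_O)\<lparr>carrier := D_ker ex_tp\<rparr>)"
    by (rule D_ker_iso)
  show "K_ker ex_tp = O_emb ` D_ker ex_tp"
    by (simp add: K_ker_ex D_ker_ex image_image O_emb_O_elem)
  show "(\<lambda>n. [n] \<cdot>\<^bsub>ex_A\<^esub> O_emb q_ex) \<in> iso integer_group (K_group ex_tp)"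
    using K_iso unfolding q_ex_O_elem O_emb_O_elem by (simp add: A_elem_add_pow)
  show "(\<lambda>n::int. (K_sq ex_tp #>\<^bsub>K_group ex_tp\<^esub> O_emb q_ex) [^]\<^bsub>C_group ex_tp\<^esub> n)
        \<in> iso integer_group (C_group ex_tp)"
    by (rule C_group_iso)
  show "\<exists>\<phi> \<in> ring_iso (ZX Quot X_ideal 3) ex_A. \<phi> (X_ideal 3 +>\<^bsub>ZX\<^esub> X_pow 1) = O_emb p_ex"
    unfolding p_ex_O_elem O_emb_O_elem by (rule ex_A_iso)
  show "\<exists>\<psi> \<in> ring_iso (ZX Quot X_ideal 2) ex_R.
      \<psi> (X_ideal 2 +>\<^bsub>ZX\<^esub> X_pow 1) = reg_rep_hat ex_tp (O_emb p_ex)"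
    unfolding p_ex_O_elem O_emb_O_elem reg_rep_hat_A_elem by (rule ex_R_iso)
  show "K_ker ex_tp = Idl\<^bsub>ex_A\<^esub> {O_emb p_ex [^]\<^bsub>ex_A\<^esub> (2::nat)}" by (rule K_ker_Idl)
  show "K_sq ex_tp = {\<zero>\<^bsub>ex_A\<^esub>}" by (rule K_sq_ex)
  show "\<exists>s. unital_additive_section ex_tp s" using unital_additive_section_ex by blast
  show "\<forall>s. unital_additive_section ex_tp s \<longrightarrow>
      regular_extension_class ex_tp = hh_class ex_R ex_K 2 (section_cocycle ex_tp s)"
    by (simp add: regular_extension_class_ex section_cocycle_ex)
  show "regular_extension_class ex_tp \<in> carrier (HH ex_R ex_K 2)"
    by (rule regular_extension_class_in_HH)
  show "regular_extension_class ex_tp \<noteq> \<one>\<^bsub>HH ex_R ex_K 2\<^esub>"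
    by (rule regular_extension_class_nonzero)
qed

end
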